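(* Let $p\in(1,2]$, $\rho>0$, and let $F:\mathbb{R}^n\to\mathbb{R}$ be a lower semicontinuous $(\rho,p)$-paraconvex function. Assume a stochastic subgradient oracle $g$ with constant $L>0$ as described in the context, and let $\{x_t\}$ be generated by the stochastic subgradient method described in the context with positive step sizes $\gamma_t$. Then, for every $0<r<(2^{p-1}\rho)^{-1}$ and every horizon $T\ge 0$, $$\mathbb{E}\left[\sum_{t=0}^T\gamma_t\, d\big(0,\partial M_F^{r}(x_t)\big)^2\right]\le \frac{p}{1-r\rho}\big(M_F^{r}(x_0)-\min F\big)+\frac{(2^{p-1}p+1)L^p}{r(1-r\rho)}\sum_{t=0}^T\gamma_t^p .$$ In particular, if the step sizes are $\gamma_t=(t+1)^{-1/p}$, then the output $x_{t^*}$ of the method satisfies $$\mathbb{E}\left[d\big(0,\partial M_F^{1/(2\rho)}(x_{t^*})\big)^2\right]\le c_1\,\frac{M_F^{1/(2\rho)}(x_0)-\min F}{(T+2)^{1-1/p}-1}+c_2\,\frac{L^p(\ln(T+1)+1)}{(T+2)^{1-1/p}-1},$$ with $c_1=2(p-1)$ and $c_2=\dfrac{4\rho(p-1)(2^{p-1}p+1)}{p}$.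
   Context: $\mathbb{R}^n$ is Euclidean space with norm $\|\cdot\|$ and inner product $\langle\cdot,\cdot\rangle$. Paraconvexity: for $p\in(1,2]$, $\rho>0$, a proper function $f:\mathbb{R}^n\to\mathbb{R}\cup\{+\infty\}$ is $(\rho,p)$-paraconvex if $f(tx+(1-t)y)\le tf(x)+(1-t)f(y)+\frac{\rho}{p}t(1-t)\|x-y\|^p$ for all $x,y\in\mathbb{R}^n$, $t\in[0,1]$. Subdifferentials: the Fréchet subdifferential of $f$ at $x\in\mathrm{dom} f$ is $\widehat\partial f(x)=\{v:\liminf_{y\to x,\,y\ne x}\frac{f(y)-f(x)-\langle v,y-x\rangle}{\|y-x\|}\ge0\}$. The limiting subdifferential $\partial f(x)$ is the set of $v$ for which there exist $x_k\to x$ with $f(x_k)\to f(x)$ and $v_k\in\widehat\partial f(x_k)$ with $v_k\to v$. For a set $S$, $d(0,S)=\inf\{\|v\|:v\in S\}$. Generalized Moreau--Yosida regularization (with kernel $h(t)=t^p/p$): for $r>0$, $M_F^r(x)=\inf_{y\in\mathbb{R}^n}\{F(y)+\frac{1}{rp}\|x-y\|^p\}$. Stochastic oracle: $(\Omega,\mathcal{F},\pi)$ is a probability space and $\mathbb{R}^n$ carries its Borel $\sigma$-algebra. (i) One can draw i.i.d. realizations $\xi_0,\xi_1,\dots$ from $\pi$. (ii) There is a measurable $g:\mathbb{R}^n\times\Omega\to\mathbb{R}^n$ with $\mathbb{E}_{\xi\sim\pi}[g(x,\xi)]\in\partial F(x)$ for all $x\in\mathbb{R}^n$. (iii) There is a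 constant $L>0$ with $\mathbb{E}_{\xi\sim\pi}\|g(x,\xi)\|^p\le L^p$ for all $x\in\mathbb{R}^n$. Stochastic subgradient method: given $x_0\in\mathbb{R}^n$ and step sizes $\gamma_t>0$, for $t=0,\dots,T$ draw $\xi_t\sim\pi$ (i.i.d.) and set $x_{t+1}=x_t-\gamma_t g(x_t,\xi_t)$. Then sample $t^*\in\{0,\dots,T\}$ (independently of the samples $\xi_t$) with $\mathbb{P}(t^*=t)=\gamma_t/\sum_{t'=0}^T\gamma_{t'}$ and output $x_{t^*}$. Expectations are over all randomness. $\min F$ denotes the minimum value of $F$ over $\mathbb{R}^n$, assumed to exist. *)

theory Defs
  imports "HOL-Probability.Probability"
begin

text \<open>
  Functions with values in \<open>\<real> \<union> {+\<infinity>}\<close> are modelled as \<open>ereal\<close>-valued functions that avoid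
  \<open>-\<infinity>\<close>; real-valued functions enter through the embedding \<open>ereal\<close>.
\<close>

definition proper :: "('a \<Rightarrow> ereal) \<Rightarrow> bool" where
  "proper f \<longleftrightarrow> (\<forall>x. f x \<noteq> -\<infinity>) \<and> (\<exists>x. f x \<noteq> \<infinity>)"

definition lower_semicontinuous :: "('a::topological_space \<Rightarrow> ereal) \<Rightarrow> bool" where
  "lower_semicontinuous f \<longleftrightarrow> (\<forall>x. f x \<le> Liminf (at x) f)"

definition paraconvex :: "real \<Rightarrow> real \<Rightarrow> ('a::euclidean_space \<Rightarrow> ereal) \<Rightarrow> bool" where
  "paraconvex \<rho> p f \<longleftrightarrow> proper f \<and>
     (\<forall>x y. \<forall>t\<in>{0..1}.
        f (t *\<^sub>R x + (1 - t) *\<^sub>R y)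
          \<le> ereal t * f x + ereal (1 - t) * f y
             + ereal (\<rho> / p * t * (1 - t) * norm (x - y) powr p))"

definition frechet_subdiff :: "('a::euclidean_space \<Rightarrow> ereal) \<Rightarrow> 'a \<Rightarrow> 'a set" where
  "frechet_subdiff f x =
     {v. \<bar>f x\<bar> \<noteq> \<infinity> \<and>
         0 \<le> Liminf (at x) (\<lambda>y. (f y - f x - ereal (inner v (y - x))) / ereal (norm (y - x)))}"

definition limiting_subdiff :: "('a::euclidean_space \<Rightarrow> ereal) \<Rightarrow> 'a \<Rightarrow> 'a set" where
  "limiting_subdiff f x =
     {v. \<bar>f x\<bar> \<noteq> \<infinity> \<and>
         (\<exists>xs vs. xs \<longlonglongrightarrow> x \<and> (\<lambda>k. f (xs k)) \<longlonglongrightarrow> f x \<and>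
                  (\<forall>k. vs k \<in> frechet_subdiff f (xs k)) \<and> vs \<longlonglongrightarrow> v)}"

text \<open>
  Unlike \<open>infdist\<close>, which is \<open>0\<close> on the empty set, this follows the convention \<open>inf {} = \<infinity>\<close>.
\<close>

definition set_distance :: "'a::metric_space \<Rightarrow> 'a set \<Rightarrow> ennreal" where
  "set_distance x S = (INF v\<in>S. ennreal (dist x v))"

definition moreau_envelope ::
    "real \<Rightarrow> real \<Rightarrow> ('a::euclidean_space \<Rightarrow> ereal) \<Rightarrow> 'a \<Rightarrow> ereal" where
  "moreau_envelope p r F x = (INF y. F y + ereal (1 / (r * p) * norm (x - y) powr p))"

text \<open>
  The moment bound makes each \<open>g x\<close> integrable, so the Bochner integral below is a genuine mean.
\<close>

definition subgradient_oracle ::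
    "'w measure \<Rightarrow> ('a::euclidean_space \<Rightarrow> 'w \<Rightarrow> 'a) \<Rightarrow> ('a \<Rightarrow> ereal) \<Rightarrow> real \<Rightarrow> real \<Rightarrow> bool" where
  "subgradient_oracle \<pi> g F p L \<longleftrightarrow>
     prob_space \<pi> \<and> L > 0 \<and>
     (\<lambda>(x, \<xi>). g x \<xi>) \<in> borel_measurable (borel \<Otimes>\<^sub>M \<pi>) \<and>
     (\<forall>x. (\<integral>\<xi>. g x \<xi> \<partial>\<pi>) \<in> limiting_subdiff F x) \<and>
     (\<forall>x. (\<integral>\<^sup>+\<xi>. ennreal (norm (g x \<xi>) powr p) \<partial>\<pi>) \<le> ennreal (L powr p))"

definition iid_samples ::
    "'s measure \<Rightarrow> 'w measure \<Rightarrow> (nat \<Rightarrow> 's \<Rightarrow> 'w) \<Rightarrow> nat \<Rightarrow> bool" where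
  "iid_samples P \<pi> \<xi> T \<longleftrightarrow>
     prob_space P \<and> prob_space.indep_vars P (\<lambda>_. \<pi>) \<xi> {..T} \<and> (\<forall>t\<le>T. distr P \<pi> (\<xi> t) = \<pi>)"

primrec subgradient_iterate ::
    "('a::real_vector \<Rightarrow> 'w \<Rightarrow> 'a) \<Rightarrow> (nat \<Rightarrow> real) \<Rightarrow> 'a \<Rightarrow> (nat \<Rightarrow> 's \<Rightarrow> 'w) \<Rightarrow> nat \<Rightarrow> 's \<Rightarrow> 'a" where
  "subgradient_iterate g \<gamma> x0 \<xi> 0 \<omega> = x0"
| "subgradient_iterate g \<gamma> x0 \<xi> (Suc t) \<omega> =
     subgradient_iterate g \<gamma> x0 \<xi> t \<omega>
       - \<gamma> t *\<^sub>R g (subgradient_iterate g \<gamma> x0 \<xi> t \<omega>) (\<xi> t \<omega>)"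

text \<open>
  The output index is independent of the joint sample \<open>(\<xi> 0, \<dots>, \<xi> T)\<close>, not merely of each
  \<open>\<xi> t\<close> separately. Independence is stated for the generated \<open>\<sigma>\<close>-algebras because \<open>indep_var\<close>
  requires both variables to have the same codomain type.
\<close>

definition output_index ::
    "'s measure \<Rightarrow> 'w measure \<Rightarrow> (nat \<Rightarrow> 's \<Rightarrow> 'w) \<Rightarrow> (nat \<Rightarrow> real) \<Rightarrow> nat \<Rightarrow> ('s \<Rightarrow> nat) \<Rightarrow> bool" where
  "output_index P \<pi> \<xi> \<gamma> T tstar \<longleftrightarrow>
     tstar \<in> measurable P (count_space {..T}) \<and>
     prob_space.indep_set P
       (sets (vimage_algebra (space P) tstar (count_space {..T})))
       (sets (vimage_algebra (space P) (\<lambda>\<omega>. \<lambda>t\<in>{..T}. \<xi> t \<omega>) (\<Pi>\<^sub>M t\<in>{..T}. \<pi>))) \<and>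
     (\<forall>t\<le>T. measure P {\<omega> \<in> space P. tstar \<omega> = t} = \<gamma> t / (\<Sum>s\<le>T. \<gamma> s))"

end

theory Submission
  imports Defs
begin

text \<open>
  Let \<open>y\<close> be any minimizer in the definition of the envelope at \<open>x\<close> and \<open>a = x - y\<close>. The envelope
  lies below \<open>F y + norm (_ - y) powr p / (r p)\<close> with equality at \<open>x\<close>, so expanding
  the \<open>p\<close>-th power of the norm around \<open>a\<close> (a step \<open>b\<close> adds an error of order \<open>norm b powr p\<close>, as \<open>p \<le> 2\<close>)
  bounds its expected value after one step. Paraconvexity and the minimality of \<open>y\<close> give
  \<open>inner a v \<ge> (1 - r \<rho>) / (r p) * norm a powr p\<close> for every subgradient \<open>v\<close> of \<open>F\<close> at \<open>x\<close>, so the expected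
  decrease controls \<open>(norm a powr (p - 1) / r)\<^sup>2\<close>, and for a suitable \<open>y\<close> this dominates
  the squared distance of \<open>0\<close> to the limiting subdifferential of the envelope. Summing over the iterations gives
  the first bound, and independence of the output index gives the second.

  The argument only needs \<open>r \<rho> < 1\<close>, which is what makes \<open>r = 1 / (2 \<rho>)\<close> admissible for \<open>p = 2\<close>, where it
  is the excluded endpoint of the range of \<open>r\<close> in the first bound.
\<close>

subsection \<open>Expansion of powers of the norm\<close>

text \<open>Concavity of \<open>\<lambda>v. v powr q\<close>: Young's inequality bounds
  \<open>v powr q * u powr (1 - q)\<close> by \<open>q * v + (1 - q) * u\<close>, and multiplying by
  \<open>u powr (q - 1)\<close> gives the tangent at \<open>u\<close>. It serves both the norm
  expansion and the sum of the step sizes.\<close>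

lemma powr_le_tangent:
  fixes u v q :: real
  assumes "0 \<le> v" "0 < u" "0 < q" "q \<le> 1"
  shows "v powr q \<le> u powr q + q * u powr (q - 1) * (v - u)"
proof (cases "v = 0")
  case True
  have "u powr (q - 1) * u = u powr q"
    using assms by (simp add: powr_diff)
  then show ?thesis
    using True assms by (simp add: mult.assoc mult_left_le_one_le)
next
  case False
  have "v powr q * u powr (1 - q) \<le> q * v + (1 - q) * u"
    using False assms by (intro Youngs_inequality_0) auto
  then have "v powr q * u powr (1 - q) * u powr (q - 1) \<le> (q * v + (1 - q) * u) * u powr (q - 1)"
    by (intro mult_right_mono) auto
  moreover have "u powr (1 - q) * u powr (q - 1) = 1"
    using assms by (simp flip: powr_add)
  moreover have "u * u powr (q - 1) = u powr q"
    using assms by (simp add: powr_diff)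
  ultimately show ?thesis
    by (simp add: algebra_simps)
qed

text \<open>Convexity of the \<open>p\<close>-th power, with the tangent taken at \<open>a\<close>;
  again Young's inequality, now with weights \<open>(p - 1) / p\<close> and
  \<open>1 / p\<close>.\<close>

lemma powr_diff_le_tangent:
  fixes a b p :: real
  assumes "1 < p" "0 \<le> a" "0 \<le> b"
  shows "a powr p - b powr p \<le> p * a powr (p - 1) * (a - b)"
proof (cases "a = 0 \<or> b = 0")
  case True
  have "a powr (p - 1) * a = a powr p"
    using assms by (cases "a = 0") (simp_all add: powr_diff)
  moreover have "1 * a powr p \<le> p * a powr p"
    using assms by (intro mult_right_mono) auto
  ultimately show ?thesis
    using True assms by (auto simp: mult.assoc)
next
  case False
  then have pos: "a > 0" "b > 0" using assms by auto
  have "(a powr p) powr ((p - 1) / p) * (b powr p) powr (1 / p)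
      \<le> (p - 1) / p * a powr p + 1 / p * b powr p"
    using assms pos by (intro Youngs_inequality_0) (auto simp: field_simps)
  then have "a powr (p - 1) * b \<le> (p - 1) / p * a powr p + 1 / p * b powr p"
    using assms pos by (simp add: powr_powr)
  then have "p * (a powr (p - 1) * b) \<le> p * ((p - 1) / p * a powr p + 1 / p * b powr p)"
    using assms by (intro mult_left_mono) auto
  then have "p * (a powr (p - 1) * b) \<le> (p - 1) * a powr p + b powr p"
    using assms by (simp add: distrib_left)
  moreover have "a powr (p - 1) * a = a powr p"
    using pos by (simp add: powr_diff)
  ultimately show ?thesis
    by (simp add: algebra_simps)
qed

lemma norm_powr_eq_power2_powr:
  fixes a :: "'a::real_normed_vector"
  shows "norm a powr p = ((norm a)\<^sup>2) powr (p / 2)"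
  by (cases "a = 0") (simp_all add: powr_powr flip: powr_numeral)

text \<open>The linear term is the derivative of \<open>norm _ powr p\<close> at \<open>a\<close> in
  direction \<open>b\<close>. A remainder of order \<open>norm b powr p\<close> instead of
  \<open>(norm b)\<^sup>2\<close> is what a bound on the \<open>p\<close>-th moment can
  control.\<close>

lemma norm_add_powr_le:
  fixes a b :: "'a::real_inner"
  assumes p: "1 < p" "p \<le> 2"
  shows "norm (a + b) powr p
    \<le> norm a powr p + p * norm a powr (p - 2) * inner a b + (p + 1) * norm b powr p"
proof (cases "a = 0")
  case True
  have "1 * norm b powr p \<le> (p + 1) * norm b powr p"
    using p by (intro mult_right_mono) auto
  then show ?thesis using True p by simp
next
  case False
  define s where "s = norm a"
  define \<beta> where "\<beta> = norm b"
  define c where "c = inner a b"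
  have s: "s > 0" and \<beta>: "\<beta> \<ge> 0"
    using False by (auto simp: s_def \<beta>_def)
  have c: "c \<ge> - s * \<beta>"
    using Cauchy_Schwarz_ineq2[of a b] by (simp add: s_def \<beta>_def c_def)
  have sq: "(norm (a + b))\<^sup>2 = s\<^sup>2 + 2 * c + \<beta>\<^sup>2"
    by (simp add: power2_norm_eq_inner s_def \<beta>_def c_def inner_simps inner_commute)
  have tangent: "norm (a + b) powr p \<le> u powr p + p / 2 * u powr (p - 2) * (s\<^sup>2 + 2 * c + \<beta>\<^sup>2 - u\<^sup>2)"
    if u: "u > 0" for u
  proof -
    have "((norm (a + b))\<^sup>2) powr (p / 2)
        \<le> (u\<^sup>2) powr (p / 2) + p / 2 * (u\<^sup>2) powr (p / 2 - 1) * ((norm (a + b))\<^sup>2 - u\<^sup>2)"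
      using p u by (intro powr_le_tangent) auto
    moreover have "(u\<^sup>2) powr (p / 2) = u powr p" "(u\<^sup>2) powr (p / 2 - 1) = u powr (p - 2)"
      using u by (simp_all add: powr_powr flip: powr_numeral)
    ultimately show ?thesis
      unfolding sq norm_powr_eq_power2_powr[of "a + b" p] by simp
  qed
  have "norm (a + b) powr p \<le> s powr p + p * s powr (p - 2) * c + (p + 1) * \<beta> powr p"
  proof (cases "\<beta> \<le> 2 * s")
    \<comment> \<open>Both cases use concavity of \<open>\<lambda>v. v powr (p / 2)\<close> in \<open>v = (norm (a + b))\<^sup>2\<close>: with the tangent at
      \<open>(norm a)\<^sup>2\<close> here, and at \<open>(norm b - norm a)\<^sup>2\<close> otherwise.\<close>
    case True
    \<comment> \<open>As \<open>p - 2\<close> is not positive, \<open>s \<ge> \<beta> / 2\<close>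
      allows \<open>s\<close> to be replaced by \<open>\<beta> / 2\<close>, at the cost of a factor
      \<open>2 powr (2 - p) \<le> 2\<close>.\<close>
    have "s powr (p - 2) * \<beta>\<^sup>2 \<le> 2 * \<beta> powr p"
    proof (cases "\<beta> = 0")
      case False
      have "s powr (p - 2) \<le> (\<beta> / 2) powr (p - 2)"
        using True False \<beta> p by (intro powr_mono2') auto
      also have "\<dots> = \<beta> powr (p - 2) * 2 powr (2 - p)"
        using \<beta> by (simp add: powr_divide powr_diff)
      also have "\<dots> \<le> \<beta> powr (p - 2) * 2 powr 1"
        using p by (intro mult_left_mono powr_mono) auto
      finally have "s powr (p - 2) * \<beta>\<^sup>2 \<le> \<beta> powr (p - 2) * 2 * \<beta>\<^sup>2"
        by (intro mult_right_mono) auto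
      also have "\<dots> = 2 * \<beta> powr p"
        using False \<beta> by (simp add: powr_diff)
      finally show ?thesis .
    qed simp
    then have "p / 2 * (s powr (p - 2) * \<beta>\<^sup>2) \<le> p / 2 * (2 * \<beta> powr p)"
      using p by (intro mult_left_mono) auto
    moreover have "p / 2 * (2 * \<beta> powr p) \<le> (p + 1) * \<beta> powr p"
      by (simp add: distrib_right)
    moreover have "norm (a + b) powr p \<le> s powr p + p / 2 * s powr (p - 2) * (2 * c + \<beta>\<^sup>2)"
      using tangent[OF s] by simp
    moreover have "p / 2 * s powr (p - 2) * (2 * c + \<beta>\<^sup>2)
        = p * s powr (p - 2) * c + p / 2 * (s powr (p - 2) * \<beta>\<^sup>2)"
      by (simp add: algebra_simps)
    ultimately show ?thesis
      by linarith
  next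
    case False
    \<comment> \<open>The smallest value that \<open>norm (a + b)\<close> can take for the given
      norms; with it the bracket in the tangent bound collapses to
      \<open>2 * (c + s * \<beta>)\<close>.\<close>
    define u where "u = \<beta> - s"
    have u: "u > 0" "u \<ge> s" "u \<le> \<beta>" using False s by (auto simp: u_def)
    have "norm (a + b) powr p \<le> u powr p + p / 2 * u powr (p - 2) * (s\<^sup>2 + 2 * c + \<beta>\<^sup>2 - u\<^sup>2)"
      by (rule tangent[OF u(1)])
    also have "s\<^sup>2 + 2 * c + \<beta>\<^sup>2 - u\<^sup>2 = 2 * (c + s * \<beta>)"
      by (simp add: u_def power2_eq_square algebra_simps)
    also have "p / 2 * u powr (p - 2) * (2 * (c + s * \<beta>)) = p * u powr (p - 2) * (c + s * \<beta>)"
      by simp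
    \<comment> \<open>Here \<open>c + s * \<beta>\<close> is nonnegative by Cauchy-Schwarz, and the
      power with exponent \<open>p - 2\<close> is nonincreasing while
      \<open>s \<le> u\<close>.\<close>
    also have "\<dots> \<le> p * s powr (p - 2) * (c + s * \<beta>)"
      using c p s u by (intro mult_right_mono mult_left_mono powr_mono2') auto
    also have "u powr p \<le> \<beta> powr p"
      using u p by (intro powr_mono2) auto
    also have "p * s powr (p - 2) * (c + s * \<beta>) \<le> p * s powr (p - 2) * c + p * \<beta> powr p"
    proof -
      have "s powr (p - 2) * s = s powr (p - 1)"
        using s by (simp add: powr_diff power2_eq_square)
      then have "s powr (p - 2) * (s * \<beta>) = s powr (p - 1) * \<beta>"
        by (simp flip: mult.assoc)
      also have "\<dots> \<le> \<beta> powr (p - 1) * \<beta>"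
        using False s p \<beta> by (intro mult_right_mono powr_mono2) auto
      also have "\<dots> = \<beta> powr p"
        using False s by (simp add: powr_diff)
      finally have "p * (s powr (p - 2) * (s * \<beta>)) \<le> p * \<beta> powr p"
        using p by (intro mult_left_mono) auto
      then show ?thesis by (simp add: algebra_simps)
    qed
    finally have "norm (a + b) powr p \<le> p * s powr (p - 2) * c + (p + 1) * \<beta> powr p"
      by (simp add: algebra_simps)
    then show ?thesis
      using powr_ge_zero[of s p] by linarith
  qed
  then show ?thesis
    by (simp add: s_def \<beta>_def c_def)
qed

subsection \<open>Subgradients\<close>

lemma frechet_subdiff_lower_bound:
  fixes f :: "'a::euclidean_space \<Rightarrow> real"
  assumes v: "v \<in> frechet_subdiff (\<lambda>x. ereal (f x)) x" and e: "e > 0"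
  shows "\<forall>\<^sub>F y in at x. f x + inner v (y - x) - e * norm (y - x) \<le> f y"
proof -
  have "0 \<le> Liminf (at x) (\<lambda>y. (ereal (f y) - ereal (f x) - ereal (inner v (y - x))) / ereal (norm (y - x)))"
    using v by (simp add: frechet_subdiff_def)
  then have "\<forall>\<^sub>F y in at x. ereal (- e) < (ereal (f y) - ereal (f x) - ereal (inner v (y - x))) / ereal (norm (y - x))"
    using e by (auto simp: le_Liminf_iff)
  then show ?thesis
  proof (rule eventually_elim2[OF _ eventually_neq_at_within[of x x UNIV]])
    fix y
    assume less: "ereal (- e) < (ereal (f y) - ereal (f x) - ereal (inner v (y - x))) / ereal (norm (y - x))"
      and "y \<noteq> x"
    then have pos: "norm (y - x) > 0" by simp
    have "- e < (f y - f x - inner v (y - x)) / norm (y - x)"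
      using less pos by simp
    then have "- e * norm (y - x) < f y - f x - inner v (y - x)"
      using pos by (simp only: pos_less_divide_eq)
    then show "f x + inner v (y - x) - e * norm (y - x) \<le> f y"
      by simp
  qed
qed

text \<open>The difference quotient is at least \<open>- k * norm (y - x)\<close>, which tends to
  \<open>0\<close>. Minimizers of a quadratically penalized function yield such minorants.\<close>

lemma frechet_subdiffI_quadratic:
  fixes f :: "'a::euclidean_space \<Rightarrow> real"
  assumes "\<And>y. f x + inner v (y - x) - k * (norm (y - x))\<^sup>2 \<le> f y"
  shows "v \<in> frechet_subdiff (\<lambda>x. ereal (f x)) x"
proof -
  have "\<forall>\<^sub>F y in at x. ereal (- k * norm (y - x))
      \<le> (ereal (f y) - ereal (f x) - ereal (inner v (y - x))) / ereal (norm (y - x))"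
  proof (rule eventually_mono[OF eventually_neq_at_within[of x x UNIV]])
    fix y assume "y \<noteq> x"
    then have pos: "norm (y - x) > 0" by simp
    have "- k * norm (y - x) * norm (y - x) \<le> f y - f x - inner v (y - x)"
      using assms[of y] by (simp add: power2_eq_square)
    then have "- k * norm (y - x) \<le> (f y - f x - inner v (y - x)) / norm (y - x)"
      using pos by (simp only: pos_le_divide_eq)
    then show "ereal (- k * norm (y - x))
      \<le> (ereal (f y) - ereal (f x) - ereal (inner v (y - x))) / ereal (norm (y - x))"
      using pos by simp
  qed
  then have "Liminf (at x) (\<lambda>y. ereal (- k * norm (y - x)))
      \<le> Liminf (at x) (\<lambda>y. (ereal (f y) - ereal (f x) - ereal (inner v (y - x))) / ereal (norm (y - x)))"
    by (rule Liminf_mono)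
  moreover have "((\<lambda>y. ereal (- k * norm (y - x))) \<longlongrightarrow> ereal (- k * norm (x - x))) (at x)"
    by (intro tendsto_intros)
  then have "Liminf (at x) (\<lambda>y. ereal (- k * norm (y - x))) = 0"
    by (subst lim_imp_Liminf) (auto simp: zero_ereal_def)
  ultimately show ?thesis
    by (simp add: frechet_subdiff_def)
qed

text \<open>A local bound becomes global along the segment from \<open>x\<close> to
  \<open>y\<close>: close to \<open>x\<close> the Frechet bound holds up to \<open>e\<close>,
  paraconvexity bounds the same value from above, and the factor \<open>t\<close> cancels.\<close>

lemma paraconvex_frechet_inequality:
  fixes f :: "'a::euclidean_space \<Rightarrow> real"
  assumes pc: "paraconvex \<rho> p (\<lambda>x. ereal (f x))" and "0 \<le> \<rho>" "0 < p"
    and v: "v \<in> frechet_subdiff (\<lambda>x. ereal (f x)) x"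
  shows "f x + inner v (y - x) - \<rho> / p * norm (y - x) powr p \<le> f y"
proof -
  define d where "d = y - x"
  have step: "inner v d - e * norm d \<le> f y - f x + \<rho> / p * norm d powr p" if e: "e > 0" for e
  proof (cases "d = 0")
    case True
    then show ?thesis by (simp add: d_def)
  next
    case False
    have lim: "((\<lambda>t. x + t *\<^sub>R d) \<longlongrightarrow> x + 0 *\<^sub>R d) (at_right 0)"
      by (intro tendsto_intros)
    then have "filterlim (\<lambda>t. x + t *\<^sub>R d) (at x) (at_right 0)"
      using False by (auto simp: filterlim_at eventually_at_filter)
    then have "\<forall>\<^sub>F t in at_right 0. f x + inner v ((x + t *\<^sub>R d) - x) - e * norm ((x + t *\<^sub>R d) - x) \<le> f (x + t *\<^sub>R d)"
      by (rule eventually_compose_filterlim[OF frechet_subdiff_lower_bound[OF v e]])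
    moreover have "\<forall>\<^sub>F t in at_right (0::real). t \<in> {0<..<1}"
      by (rule eventually_at_right_real) simp
    ultimately have "\<forall>\<^sub>F t in at_right (0::real). t \<in> {0<..<1} \<and>
        f x + inner v ((x + t *\<^sub>R d) - x) - e * norm ((x + t *\<^sub>R d) - x) \<le> f (x + t *\<^sub>R d)"
      by eventually_elim auto
    then obtain t :: real where t: "0 < t" "t < 1"
      and fr: "f x + inner v ((x + t *\<^sub>R d) - x) - e * norm ((x + t *\<^sub>R d) - x) \<le> f (x + t *\<^sub>R d)"
      using eventually_happens[of _ "at_right (0::real)"] by force
    have "ereal (f (t *\<^sub>R y + (1 - t) *\<^sub>R x)) \<le> ereal t * ereal (f y) + ereal (1 - t) * ereal (f x)
             + ereal (\<rho> / p * t * (1 - t) * norm (y - x) powr p)"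
      using pc t unfolding paraconvex_def by (metis atLeastAtMost_iff less_imp_le)
    then have "f (t *\<^sub>R y + (1 - t) *\<^sub>R x) \<le> t * f y + (1 - t) * f x + \<rho> / p * t * (1 - t) * norm d powr p"
      by (simp add: d_def)
    moreover have "t *\<^sub>R y + (1 - t) *\<^sub>R x = x + t *\<^sub>R d"
      by (simp add: d_def algebra_simps)
    \<comment> \<open>Bounding \<open>1 - t\<close> by \<open>1\<close> leaves \<open>t\<close> as a
      common factor, so a single small \<open>t\<close> suffices instead of a limit.\<close>
    moreover have "\<rho> / p * t * (1 - t) * norm d powr p \<le> \<rho> / p * t * 1 * norm d powr p"
      using assms t by (intro mult_right_mono mult_left_mono) auto
    ultimately have "t * (inner v d - e * norm d) \<le> t * (f y - f x + \<rho> / p * norm d powr p)"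
      using fr t by (simp add: algebra_simps)
    then show ?thesis using t by simp
  qed
  have "inner v d \<le> f y - f x + \<rho> / p * norm d powr p"
  proof (rule field_le_epsilon)
    fix e :: real assume "e > 0"
    \<comment> \<open>Scaling by \<open>norm d + 1\<close> turns the error proportional to
      \<open>norm d\<close> into one of at most \<open>e\<close>, also for
      \<open>d = 0\<close>.\<close>
    then have "e / (norm d + 1) > 0" "e / (norm d + 1) * norm d \<le> e"
      by (simp_all add: field_simps add_pos_nonneg)
    then show "inner v d \<le> f y - f x + \<rho> / p * norm d powr p + e"
      using step[of "e / (norm d + 1)"] by linarith
  qed
  then show ?thesis by (simp add: d_def)
qed

text \<open>Every term of the Frechet inequality at \<open>xs k\<close> converges; for
  \<open>f (xs k)\<close> this is part of the definition of a limiting subgradient.\<close>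

lemma paraconvex_subgradient_inequality:
  fixes f :: "'a::euclidean_space \<Rightarrow> real"
  assumes pc: "paraconvex \<rho> p (\<lambda>x. ereal (f x))" and "0 \<le> \<rho>" "0 < p"
    and v: "v \<in> limiting_subdiff (\<lambda>x. ereal (f x)) x"
  shows "f x + inner v (y - x) - \<rho> / p * norm (y - x) powr p \<le> f y"
proof -
  obtain xs vs where xs: "xs \<longlonglongrightarrow> x" and fx: "(\<lambda>k. f (xs k)) \<longlonglongrightarrow> f x"
    and vs: "\<And>k. vs k \<in> frechet_subdiff (\<lambda>x. ereal (f x)) (xs k)" "vs \<longlonglongrightarrow> v"
    using v by (auto simp: limiting_subdiff_def)
  have "(\<lambda>k. f (xs k) + inner (vs k) (y - xs k) - \<rho> / p * norm (y - xs k) powr p)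
      \<longlonglongrightarrow> f x + inner v (y - x) - \<rho> / p * norm (y - x) powr p"
    using assms by (intro tendsto_intros tendsto_powr' xs fx vs) auto
  then show ?thesis
    by (rule tendsto_upperbound)
       (simp_all only: always_eventually paraconvex_frechet_inequality[OF assms(1-3) vs(1)] trivial_limit_sequentially not_False_eq_True simp_thms)
qed

lemma lower_semicontinuous_eventually:
  fixes f :: "'a::topological_space \<Rightarrow> real"
  assumes "lower_semicontinuous (\<lambda>x. ereal (f x))" and "ys \<longlonglongrightarrow> y" and "e > 0"
  shows "\<forall>\<^sub>F k in sequentially. f y - e < f (ys k)"
proof -
  have "ereal (f y - e) < ereal (f y)" using assms by simp
  then have "\<forall>\<^sub>F w in at y. ereal (f y - e) < ereal (f w)"
    using assms(1) unfolding lower_semicontinuous_def le_Liminf_iff by blast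
  \<comment> \<open>The filter \<open>at y\<close> omits \<open>y\<close>, which the sequence may
    hit; there the strict inequality holds because \<open>e > 0\<close>.\<close>
  then have "\<forall>\<^sub>F w in nhds y. f y - e < f w"
    using assms by (simp add: eventually_nhds_conv_at)
  then show ?thesis
    using assms(2) by (rule eventually_compose_filterlim)
qed

subsection \<open>The generalized Moreau envelope\<close>

text \<open>The minimizer \<open>z\<close> is a parameter because it is used twice:
  \<open>F z\<close> bounds all costs from below, and comparison with \<open>z\<close> localizes the
  proximal points.\<close>

locale moreau_envelope_setting =
  fixes F :: "'a::euclidean_space \<Rightarrow> real" and p r :: real and z :: 'a
  assumes p: "1 < p" and r: "0 < r"
    and lsc: "lower_semicontinuous (\<lambda>x. ereal (F x))"
    and z_min: "F z \<le> F y"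
begin

definition cost :: "'a \<Rightarrow> 'a \<Rightarrow> real" where
  "cost x y = F y + 1 / (r * p) * norm (x - y) powr p"

text \<open>Real-valued, as all costs are at least \<open>F z\<close>;
  \<open>moreau_envelope_eq\<close> returns to the extended reals.\<close>

definition env :: "'a \<Rightarrow> real" where
  "env x = (INF y. cost x y)"

text \<open>A set, since without convexity of \<open>F\<close> a minimizer need not be
  unique.\<close>

definition prox :: "'a \<Rightarrow> 'a set" where
  "prox x = {y. cost x y = env x}"

lemma cost_ge: "F z \<le> cost x y"
  using z_min[of y] p r by (simp add: cost_def add_increasing2)

lemma bdd_below_cost: "bdd_below (range (cost x))"
  using cost_ge by (intro bdd_belowI2)

lemma env_le_cost: "env x \<le> cost x y"
  unfolding env_def by (intro cINF_lower bdd_below_cost) auto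

lemma env_ge: "F z \<le> env x"
  unfolding env_def by (intro cINF_greatest cost_ge) auto

lemma moreau_envelope_eq: "moreau_envelope p r (\<lambda>x. ereal (F x)) x = ereal (env x)"
proof -
  have "ereal (Inf (range (cost x))) = (INF c\<in>range (cost x). ereal c)"
    by (intro ereal_Inf' bdd_below_cost) auto
  then have "ereal (env x) = (INF y. ereal (cost x y))"
    by (simp add: env_def image_comp)
  then show ?thesis
    by (simp add: moreau_envelope_def cost_def)
qed

section \<open>Existence and location of proximal points\<close>

lemma tendsto_penalty:
  "xs \<longlonglongrightarrow> x \<Longrightarrow> ys \<longlonglongrightarrow> y \<Longrightarrow>
    (\<lambda>k. 1 / (r * p) * norm (xs k - ys k) powr p) \<longlonglongrightarrow> 1 / (r * p) * norm (x - y) powr p"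
  using p by (intro tendsto_intros tendsto_powr') auto

text \<open>The penalty is continuous and \<open>F\<close> can only drop in the limit. The upper
  bounds \<open>ms\<close> cover both a minimizing sequence at a fixed point and exact proximal
  points of a convergent sequence.\<close>

lemma prox_limit:
  assumes xs: "xs \<longlonglongrightarrow> x" and ys: "ys \<longlonglongrightarrow> y"
    and m: "\<And>k. cost (xs k) (ys k) \<le> ms k" "ms \<longlonglongrightarrow> env x"
  shows "y \<in> prox x"
proof -
  let ?pen = "\<lambda>x y. 1 / (r * p) * norm (x - y) powr p"
  have "cost x y \<le> env x"
  proof (rule field_le_epsilon)
    fix e :: real assume e: "e > 0"
    have "(\<lambda>k. ms k - ?pen (xs k) (ys k)) \<longlonglongrightarrow> env x - ?pen x y"
      by (intro tendsto_diff m tendsto_penalty xs ys)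
    moreover have "\<forall>\<^sub>F k in sequentially. F y - e \<le> ms k - ?pen (xs k) (ys k)"
      using lower_semicontinuous_eventually[OF lsc ys e]
    proof eventually_elim
      case (elim k)
      then show ?case using m(1)[of k] by (simp add: cost_def)
    qed
    ultimately have "F y - e \<le> env x - ?pen x y"
      by (rule tendsto_lowerbound) auto
    then show "cost x y \<le> env x + e" by (simp add: cost_def)
  qed
  then show ?thesis
    using env_le_cost[of x y] by (auto simp: prox_def)
qed

text \<open>A minimizing sequence is bounded, because \<open>F \<ge> F z\<close> forces its
  penalties to stay bounded; a limit of a subsequence is then a minimizer.\<close>

lemma prox_nonempty: "\<exists>y. y \<in> prox x"
proof -
  have "\<exists>y. cost x y < env x + inverse (real (Suc k))" for k
    using cINF_less_iff[OF _ bdd_below_cost, of x "env x + inverse (real (Suc k))"]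
    by (auto simp: env_def)
  then obtain ys where ys: "\<And>k. cost x (ys k) < env x + inverse (real (Suc k))"
    by metis
  have "norm (x - ys k) powr p \<le> r * p * (env x + 1 - F z)" for k
  proof -
    have "inverse (real (Suc k)) \<le> 1" by (simp add: field_simps)
    then have "1 / (r * p) * norm (x - ys k) powr p \<le> env x + 1 - F z"
      using ys[of k] z_min[of "ys k"] by (simp add: cost_def)
    then show ?thesis using p r by (simp add: field_simps)
  qed
  then have "norm (x - ys k) \<le> (r * p * (env x + 1 - F z)) powr (1 / p)" for k
    using powr_mono2[of "1 / p" "norm (x - ys k) powr p"] p by (simp add: powr_powr)
  then have "bounded (range ys)"
    unfolding bounded_def dist_norm by blast
  then obtain y s where s: "strict_mono s" and lim: "(ys \<circ> s) \<longlonglongrightarrow> y"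
    using bounded_imp_convergent_subsequence by blast
  have "y \<in> prox x"
  proof (rule prox_limit[OF tendsto_const lim])
    show "cost x ((ys \<circ> s) k) \<le> env x + inverse (real (Suc (s k)))" for k
      using ys[of "s k"] by simp
    have "(\<lambda>k. env x + inverse (real (Suc k))) \<longlonglongrightarrow> env x + 0"
      by (intro tendsto_add tendsto_const LIMSEQ_inverse_real_of_nat)
    then show "(\<lambda>k. env x + inverse (real (Suc (s k)))) \<longlonglongrightarrow> env x"
      using LIMSEQ_subseq_LIMSEQ[OF _ s] by (fastforce simp: o_def)
  qed
  then show ?thesis ..
qed

lemma env_eq_cost: "y \<in> prox x \<Longrightarrow> env x = cost x y"
  by (simp add: prox_def)

text \<open>Competing against \<open>z\<close>: since \<open>F z \<le> F y\<close>, the penalty of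
  \<open>y\<close> cannot exceed that of \<open>z\<close>. This gives locally uniform bounds on
  proximal points.\<close>

lemma prox_dist_le:
  assumes "y \<in> prox x"
  shows "norm (x - y) \<le> norm (x - z)"
proof -
  have "cost x y \<le> cost x z"
    using assms env_le_cost[of x z] by (simp add: prox_def)
  then have "1 / (r * p) * norm (x - y) powr p \<le> 1 / (r * p) * norm (x - z) powr p"
    using z_min[of y] by (simp add: cost_def)
  then have "norm (x - y) powr p \<le> norm (x - z) powr p"
    using p r by (simp add: field_simps)
  then show ?thesis
    using p powr_less_mono2[of p "norm (x - z)" "norm (x - y)"] by force
qed

section \<open>Continuity of the envelope\<close>

text \<open>The point \<open>y\<close> remains a competitor at \<open>w\<close>, so the envelope
  grows by at most the change of the penalty, which convexity of the \<open>p\<close>-th power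
  bounds.\<close>

lemma env_diff_le:
  assumes y: "y \<in> prox x"
  shows "env w - env x \<le> 1 / r * norm (w - y) powr (p - 1) * norm (w - x)"
proof -
  have "env w - env x \<le> 1 / (r * p) * (norm (w - y) powr p - norm (x - y) powr p)"
    using env_le_cost[of w y] env_eq_cost[OF y] by (simp add: cost_def algebra_simps)
  also have "\<dots> \<le> 1 / (r * p) * (p * norm (w - y) powr (p - 1) * (norm (w - y) - norm (x - y)))"
    using p r by (intro mult_left_mono powr_diff_le_tangent) auto
  also have "\<dots> \<le> 1 / (r * p) * (p * norm (w - y) powr (p - 1) * norm (w - x))"
    using p r norm_triangle_ineq2[of "w - y" "x - y"] by (intro mult_left_mono) auto
  also have "\<dots> = 1 / r * norm (w - y) powr (p - 1) * norm (w - x)"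
    using p by simp
  finally show ?thesis .
qed

lemma isCont_env: "isCont env x"
proof -
  \<comment> \<open>The sum of the three norms dominates both radii that occur: from
    \<open>w\<close> to a proximal point of \<open>x\<close>, and from \<open>x\<close> to one of
    \<open>w\<close>. Each serves one direction of the estimate.\<close>
  define B where "B w = 1 / r * (norm (w - x) + norm (w - z) + norm (x - z)) powr (p - 1) * norm (w - x)" for w
  have "\<bar>env w - env x\<bar> \<le> B w" for w
  proof -
    obtain y where y: "y \<in> prox x" using prox_nonempty by blast
    obtain y' where y': "y' \<in> prox w" using prox_nonempty by blast
    have "norm (w - y) \<le> norm (w - x) + norm (w - z) + norm (x - z)"
      using prox_dist_le[OF y] norm_triangle_ineq[of "w - x" "x - y"]
        norm_ge_zero[of "w - z"] by (simp del: norm_ge_zero)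
    then have "1 / r * norm (w - y) powr (p - 1) * norm (w - x) \<le> B w"
      unfolding B_def using p r by (intro mult_right_mono mult_left_mono powr_mono2) auto
    moreover have "norm (x - y') \<le> norm (w - x) + norm (w - z) + norm (x - z)"
      using prox_dist_le[OF y'] norm_triangle_ineq[of "x - w" "w - y'"]
        norm_ge_zero[of "x - z"] by (simp add: norm_minus_commute del: norm_ge_zero)
    then have "1 / r * norm (x - y') powr (p - 1) * norm (w - x) \<le> B w"
      unfolding B_def using p r by (intro mult_right_mono mult_left_mono powr_mono2) auto
    ultimately show ?thesis
      using env_diff_le[OF y, of w] env_diff_le[OF y', of x]
      by (simp add: norm_minus_commute abs_le_iff)
  qed
  moreover have "(B \<longlongrightarrow> 1 / r * (norm (x - x) + norm (x - z) + norm (x - z)) powr (p - 1) * norm (x - x)) (at x)"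
    unfolding B_def using p by (intro tendsto_intros tendsto_powr') auto
  then have "(B \<longlongrightarrow> 0) (at x)" by simp
  ultimately have "((\<lambda>w. env w - env x) \<longlongrightarrow> 0) (at x)"
    by (intro Lim_null_comparison[of "\<lambda>w. env w - env x" B "at x"] always_eventually) (simp_all only: real_norm_def simp_thms)
  then show ?thesis
    by (simp add: isCont_def LIM_zero_iff)
qed

lemma continuous_env: "continuous_on UNIV env"
  using isCont_env by (simp add: continuous_at_imp_continuous_on)

section \<open>Limiting subgradients of the envelope\<close>

text \<open>Moving from \<open>x\<close> in direction \<open>v\<close> itself, the minorant grows by
  about \<open>t * (norm v)\<^sup>2\<close> while \<open>env_diff_le\<close> caps the growth.
  Dividing by \<open>t * norm v\<close> and letting \<open>t\<close> tend to \<open>0\<close> gives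
  the bound, for every proximal point \<open>y\<close>.\<close>

lemma subgradient_norm_le:
  assumes y: "y \<in> prox x"
    and v: "\<And>w. env x + inner v (w - x) - k * (norm (w - x))\<^sup>2 \<le> env w"
  shows "norm v \<le> 1 / r * norm (x - y) powr (p - 1)"
proof (cases "v = 0")
  case False
  have "norm v - k * t * norm v \<le> 1 / r * norm (x + t *\<^sub>R v - y) powr (p - 1)" if t: "t > 0" for t
  proof -
    have "inner v (t *\<^sub>R v) - k * (norm (t *\<^sub>R v))\<^sup>2 \<le> 1 / r * norm (x + t *\<^sub>R v - y) powr (p - 1) * norm (t *\<^sub>R v)"
      using v[of "x + t *\<^sub>R v"] env_diff_le[OF y, of "x + t *\<^sub>R v"] by simp
    then have "(t * norm v) * (norm v - k * t * norm v) \<le> (t * norm v) * (1 / r * norm (x + t *\<^sub>R v - y) powr (p - 1))"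
      using t by (simp add: power2_eq_square algebra_simps flip: power2_norm_eq_inner)
    moreover have "t * norm v > 0"
      using t False by simp
    ultimately show ?thesis
      by (simp only: mult_le_cancel_left_pos)
  qed
  then have "\<forall>\<^sub>F t in at_right 0. norm v - k * t * norm v \<le> 1 / r * norm (x + t *\<^sub>R v - y) powr (p - 1)"
    by (auto simp: eventually_at_filter)
  moreover have "((\<lambda>t. norm v - k * t * norm v) \<longlongrightarrow> norm v - k * 0 * norm v) (at_right 0)"
    by (intro tendsto_intros)
  moreover have "((\<lambda>t. 1 / r * norm (x + t *\<^sub>R v - y) powr (p - 1))
      \<longlongrightarrow> 1 / r * norm (x + 0 *\<^sub>R v - y) powr (p - 1)) (at_right 0)"
    using p by (intro tendsto_intros tendsto_powr') auto
  ultimately have "norm v - k * 0 * norm v \<le> 1 / r * norm (x + 0 *\<^sub>R v - y) powr (p - 1)"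
    by (intro tendsto_le[of "at_right (0::real)"]) auto
  then show ?thesis by simp
qed (use r in auto)

lemma penalized_env_attains_min:
  assumes "k > 0"
  shows "\<exists>w. \<forall>w'. env w + k * (norm (w - x))\<^sup>2 \<le> env w' + k * (norm (w' - x))\<^sup>2"
proof -
  \<comment> \<open>Outside the ball of this radius the penalty alone is at least
    \<open>env x - F z\<close>, so no point there beats \<open>x\<close>; a minimum over the compact
    ball is global.\<close>
  define R where "R = sqrt ((env x - F z) / k)"
  have R: "R \<ge> 0" "k * R\<^sup>2 = env x - F z"
    using assms env_ge[of x] by (simp_all add: R_def)
  have "\<exists>w\<in>cball x R. \<forall>w'\<in>cball x R. env w + k * (norm (w - x))\<^sup>2 \<le> env w' + k * (norm (w' - x))\<^sup>2"
    using R by (intro continuous_attains_inf compact_cball continuous_intros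
        continuous_on_subset[OF continuous_env]) auto
  then obtain w where w: "\<And>w'. w' \<in> cball x R \<Longrightarrow> env w + k * (norm (w - x))\<^sup>2 \<le> env w' + k * (norm (w' - x))\<^sup>2"
    by blast
  have "env w + k * (norm (w - x))\<^sup>2 \<le> env w' + k * (norm (w' - x))\<^sup>2" for w'
  proof (cases "w' \<in> cball x R")
    case False
    then have "R\<^sup>2 \<le> (norm (w' - x))\<^sup>2"
      using R by (intro power_mono) (auto simp: dist_norm norm_minus_commute)
    then have "k * R\<^sup>2 \<le> k * (norm (w' - x))\<^sup>2"
      using assms by (intro mult_left_mono) auto
    then show ?thesis
      using w[of x] R env_ge[of w'] by simp
  qed (rule w)
  then show ?thesis by blast
qed

text \<open>
  Minimizers of \<open>env\<close> plus the penalty \<open>(k + 1) * (norm (_ - x))\<^sup>2\<close> converge to \<open>x\<close> and carry Frechet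
  subgradients; the point \<open>y\<close> is a limit of their proximal points.
\<close>

lemma limiting_subgradient_exists:
  "\<exists>y v. y \<in> prox x \<and> v \<in> limiting_subdiff (\<lambda>x. ereal (env x)) x
    \<and> norm v \<le> 1 / r * norm (x - y) powr (p - 1)"
proof -
  have "\<exists>w. \<forall>w'. env w + real (Suc k) * (norm (w - x))\<^sup>2 \<le> env w' + real (Suc k) * (norm (w' - x))\<^sup>2" for k
    by (rule penalized_env_attains_min) simp
  then obtain xs where xs: "\<And>k w. env (xs k) + real (Suc k) * (norm (xs k - x))\<^sup>2 \<le> env w + real (Suc k) * (norm (w - x))\<^sup>2"
    by metis
  define ys where "ys k = (SOME y. y \<in> prox (xs k))" for k
  have ys: "ys k \<in> prox (xs k)" for k
    unfolding ys_def by (rule someI_ex) (rule prox_nonempty)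
  \<comment> \<open>Minus the gradient at \<open>xs k\<close> of the penalty
    \<open>real (Suc k) * (norm (_ - x))\<^sup>2\<close>; expanding the penalty around
    \<open>xs k\<close> turns minimality into a quadratic minorant.\<close>
  define vs where "vs k = - (2 * real (Suc k)) *\<^sub>R (xs k - x)" for k
  have quad: "env (xs k) + inner (vs k) (w - xs k) - real (Suc k) * (norm (w - xs k))\<^sup>2 \<le> env w" for k w
  proof -
    have "(norm (w - x))\<^sup>2 = (norm (w - xs k))\<^sup>2 + 2 * inner (xs k - x) (w - xs k) + (norm (xs k - x))\<^sup>2"
      by (simp add: power2_norm_eq_inner inner_simps inner_commute)
    then have "real (Suc k) * (norm (w - x))\<^sup>2 = real (Suc k) * (norm (w - xs k))\<^sup>2
        + 2 * real (Suc k) * inner (xs k - x) (w - xs k) + real (Suc k) * (norm (xs k - x))\<^sup>2"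
      by (simp only: distrib_left mult.assoc mult.left_commute)
    moreover have "inner (vs k) (w - xs k) = - (2 * real (Suc k) * inner (xs k - x) (w - xs k))"
      by (simp add: vs_def del: of_nat_Suc)
    ultimately show ?thesis
      using xs[of k w] by linarith
  qed
  have vs_le: "norm (vs k) \<le> 1 / r * norm (xs k - ys k) powr (p - 1)" for k
    by (rule subgradient_norm_le[OF ys quad])
  have close: "(norm (xs k - x))\<^sup>2 \<le> (env x - F z) * inverse (real (Suc k))" for k
  proof -
    have "real (Suc k) * (norm (xs k - x))\<^sup>2 \<le> env x - F z"
      using xs[of k x] env_ge[of "xs k"] by simp
    then show ?thesis by (simp add: field_simps del: of_nat_Suc)
  qed
  have xs_lim: "xs \<longlonglongrightarrow> x"
  proof -
    have "(\<lambda>k. (env x - F z) * inverse (real (Suc k))) \<longlonglongrightarrow> (env x - F z) * 0"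
      by (intro tendsto_mult tendsto_const LIMSEQ_inverse_real_of_nat)
    then have "(\<lambda>k. (env x - F z) * inverse (real (Suc k))) \<longlonglongrightarrow> 0"
      by simp
    then have "(\<lambda>k. (norm (xs k - x))\<^sup>2) \<longlonglongrightarrow> 0"
      by (rule Lim_null_comparison[rotated]) (simp add: close del: of_nat_Suc)
    then have "(\<lambda>k. norm (xs k - x)) \<longlonglongrightarrow> 0"
      using tendsto_real_sqrt[of "\<lambda>k. (norm (xs k - x))\<^sup>2" 0] by simp
    then show ?thesis
      by (simp add: tendsto_norm_zero_iff LIM_zero_iff)
  qed
  obtain B where B: "\<And>k. norm (xs k - z) \<le> B"
    using convergent_imp_bounded[OF tendsto_diff[OF xs_lim tendsto_const[of z]]]
    by (auto simp: bounded_iff)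
  have "norm (ys k) \<le> B + B + norm z" for k
    using prox_dist_le[OF ys[of k]] B[of k] norm_triangle_ineq4[of "xs k - z" "xs k - ys k"]
      norm_triangle_ineq[of "ys k - z" z] by simp
  moreover have "norm (vs k) \<le> 1 / r * B powr (p - 1)" for k
  proof -
    have "norm (xs k - ys k) powr (p - 1) \<le> B powr (p - 1)"
      using prox_dist_le[OF ys[of k]] B[of k] p by (intro powr_mono2) auto
    then have "1 / r * norm (xs k - ys k) powr (p - 1) \<le> 1 / r * B powr (p - 1)"
      using r by (intro mult_left_mono) auto
    then show ?thesis using vs_le[of k] by simp
  qed
  \<comment> \<open>Working with pairs gives one subsequence along which proximal points and
    subgradients converge together.\<close>
  ultimately have "bounded (range ys \<times> range vs)"
    by (intro bounded_Times) (auto simp: bounded_iff)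
  then have "bounded (range (\<lambda>k. (ys k, vs k)))"
    by (rule bounded_subset) auto
  then obtain l s where s: "strict_mono s" and l: "((\<lambda>k. (ys k, vs k)) \<circ> s) \<longlonglongrightarrow> l"
    using bounded_imp_convergent_subsequence by blast
  define y where "y = fst l"
  define v where "v = snd l"
  have ylim: "(\<lambda>k. ys (s k)) \<longlonglongrightarrow> y" and vlim: "(\<lambda>k. vs (s k)) \<longlonglongrightarrow> v"
    using tendsto_fst[OF l] tendsto_snd[OF l] by (auto simp: o_def y_def v_def)
  have xlim: "(\<lambda>k. xs (s k)) \<longlonglongrightarrow> x"
    using LIMSEQ_subseq_LIMSEQ[OF xs_lim s] by (simp add: o_def)
  have elim: "(\<lambda>k. env (xs (s k))) \<longlonglongrightarrow> env x"
    using isCont_tendsto_compose[OF isCont_env xlim] .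
  have "y \<in> prox x"
    by (rule prox_limit[OF xlim ylim _ elim]) (simp add: env_eq_cost[OF ys])
  moreover have "v \<in> limiting_subdiff (\<lambda>x. ereal (env x)) x"
    unfolding limiting_subdiff_def mem_Collect_eq
    using xlim elim vlim frechet_subdiffI_quadratic[OF quad]
    by (intro conjI exI[of "\<lambda>xs. \<exists>vs. _ xs vs" "\<lambda>k. xs (s k)"] exI[of _ "\<lambda>k. vs (s k)"]) auto
  moreover have "norm v \<le> 1 / r * norm (x - y) powr (p - 1)"
  proof (rule tendsto_le)
    show "(\<lambda>k. norm (vs (s k))) \<longlonglongrightarrow> norm v"
      by (intro tendsto_intros vlim)
    show "(\<lambda>k. 1 / r * norm (xs (s k) - ys (s k)) powr (p - 1)) \<longlonglongrightarrow> 1 / r * norm (x - y) powr (p - 1)"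
      using p by (intro tendsto_intros tendsto_powr' xlim ylim) auto
    show "\<forall>\<^sub>F k in sequentially. norm (vs (s k)) \<le> 1 / r * norm (xs (s k) - ys (s k)) powr (p - 1)"
      using vs_le by (intro always_eventually allI)
  qed simp
  ultimately show ?thesis by blast
qed

end

subsection \<open>Sampling\<close>

text \<open>Iterate \<open>t\<close> depends only on the samples before \<open>t\<close>. The two
  sample spaces may differ, so iterates can be transported to a product space of sample
  sequences.\<close>

lemma subgradient_iterate_cong:
  assumes "\<And>i. i < t \<Longrightarrow> \<xi> i \<omega> = \<xi>' i \<omega>'"
  shows "subgradient_iterate g \<gamma> x0 \<xi> t \<omega> = subgradient_iterate g \<gamma> x0 \<xi>' t \<omega>'"
  using assms by (induction t) simp_all

lemma measurable_subgradient_iterate: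
  fixes g :: "'a::euclidean_space \<Rightarrow> 'w \<Rightarrow> 'a"
  assumes g: "(\<lambda>(x, u). g x u) \<in> borel_measurable (borel \<Otimes>\<^sub>M \<pi>)"
    and \<xi>: "\<And>i. i < t \<Longrightarrow> \<xi> i \<in> measurable M \<pi>"
  shows "subgradient_iterate g \<gamma> x0 \<xi> t \<in> borel_measurable M"
  using \<xi>
proof (induction t)
  case 0
  then show ?case by simp
next
  case (Suc t)
  have x: "subgradient_iterate g \<gamma> x0 \<xi> t \<in> borel_measurable M"
    using Suc by simp
  have "(\<lambda>\<omega>. (subgradient_iterate g \<gamma> x0 \<xi> t \<omega>, \<xi> t \<omega>)) \<in> measurable M (borel \<Otimes>\<^sub>M \<pi>)"
    using x Suc.prems[of t] by (intro measurable_Pair) auto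
  from measurable_compose[OF this g] x show ?case
    by simp
qed

text \<open>Independence and equal laws make the joint law of the samples a product measure, from
  which Fubini splits off the last coordinate.\<close>

lemma nn_integral_samples_PiM:
  assumes iid: "iid_samples P \<pi> \<xi> T" and "prob_space \<pi>" and t: "t \<le> T"
    and h[measurable]: "h \<in> borel_measurable (\<Pi>\<^sub>M i\<in>{..t}. \<pi>)"
  shows "(\<integral>\<^sup>+\<omega>. h (\<lambda>i\<in>{..t}. \<xi> i \<omega>) \<partial>P)
    = (\<integral>\<^sup>+s. (\<integral>\<^sup>+u. h (s(t := u)) \<partial>\<pi>) \<partial>(\<Pi>\<^sub>M i\<in>{..<t}. \<pi>))"
proof -
  interpret P: prob_space P using iid by (simp add: iid_samples_def)
  interpret \<pi>: prob_space \<pi> by fact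
  interpret product_sigma_finite "\<lambda>_::nat. \<pi>" by standard
  have ind: "P.indep_vars (\<lambda>_. \<pi>) \<xi> {..t}"
  proof (rule P.indep_vars_subset)
    show "P.indep_vars (\<lambda>_. \<pi>) \<xi> {..T}"
      using iid unfolding iid_samples_def by blast
  qed (use t in simp)
  from this have rv: "\<And>i. i \<in> {..t} \<Longrightarrow> \<xi> i \<in> measurable P \<pi>"
    unfolding P.indep_vars_def by blast
  have "distr P (\<Pi>\<^sub>M i\<in>{..t}. \<pi>) (\<lambda>\<omega>. \<lambda>i\<in>{..t}. \<xi> i \<omega>) = (\<Pi>\<^sub>M i\<in>{..t}. distr P \<pi> (\<xi> i))"
    by (rule iffD1[OF P.indep_vars_iff_distr_eq_PiM' ind, OF _ rv]) auto
  also have "\<dots> = (\<Pi>\<^sub>M i\<in>{..t}. \<pi>)"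
    using iid t by (intro PiM_cong) (auto simp: iid_samples_def)
  finally have distr: "distr P (\<Pi>\<^sub>M i\<in>{..t}. \<pi>) (\<lambda>\<omega>. \<lambda>i\<in>{..t}. \<xi> i \<omega>) = (\<Pi>\<^sub>M i\<in>{..t}. \<pi>)" .
  have "(\<integral>\<^sup>+\<omega>. h (\<lambda>i\<in>{..t}. \<xi> i \<omega>) \<partial>P) = (\<integral>\<^sup>+s. h s \<partial>distr P (\<Pi>\<^sub>M i\<in>{..t}. \<pi>) (\<lambda>\<omega>. \<lambda>i\<in>{..t}. \<xi> i \<omega>))"
    using rv by (intro nn_integral_distr[symmetric] measurable_restrict h) auto
  also have "\<dots> = (\<integral>\<^sup>+s. h s \<partial>(\<Pi>\<^sub>M i\<in>insert t {..<t}. \<pi>))"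
    unfolding distr by (simp only: lessThan_Suc[symmetric] lessThan_Suc_atMost)
  also have "\<dots> = (\<integral>\<^sup>+s. (\<integral>\<^sup>+u. h (s(t := u)) \<partial>\<pi>) \<partial>(\<Pi>\<^sub>M i\<in>{..<t}. \<pi>))"
    using h by (intro product_nn_integral_insert) (simp_all only: lessThan_Suc[symmetric] lessThan_Suc_atMost finite_lessThan lessThan_iff less_irrefl not_False_eq_True)
  finally show ?thesis .
qed

text \<open>The tower property without conditional expectations: \<open>\<xi> t\<close> is fresh
  relative to iterate \<open>t\<close>, so it may be integrated out with the iterate held
  fixed.\<close>

lemma nn_integral_iterate_sample:
  fixes g :: "'a::euclidean_space \<Rightarrow> 'w \<Rightarrow> 'a"
  assumes iid: "iid_samples P \<pi> \<xi> T" and \<pi>: "prob_space \<pi>" and t: "t \<le> T"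
    and g: "(\<lambda>(x, u). g x u) \<in> borel_measurable (borel \<Otimes>\<^sub>M \<pi>)"
    and f[measurable]: "(\<lambda>(x, u). f x u) \<in> borel_measurable (borel \<Otimes>\<^sub>M \<pi>)"
  shows "(\<integral>\<^sup>+\<omega>. f (subgradient_iterate g \<gamma> x0 \<xi> t \<omega>) (\<xi> t \<omega>) \<partial>P)
    = (\<integral>\<^sup>+\<omega>. (\<integral>\<^sup>+u. f (subgradient_iterate g \<gamma> x0 \<xi> t \<omega>) u \<partial>\<pi>) \<partial>P)"
proof -
  interpret \<pi>: prob_space \<pi> by fact
  define X where "X = subgradient_iterate g \<gamma> x0 (\<lambda>i (s::nat \<Rightarrow> 'w). s i) t"
  have X[measurable]: "X \<in> borel_measurable (\<Pi>\<^sub>M i\<in>{..t}. \<pi>)"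
    unfolding X_def by (intro measurable_subgradient_iterate[OF g]) measurable
  have X_eq: "subgradient_iterate g \<gamma> x0 \<xi> t \<omega> = X (\<lambda>i\<in>{..t}. \<xi> i \<omega>)" for \<omega>
    unfolding X_def by (rule subgradient_iterate_cong) simp
  have X_upd: "X (s(t := u)) = X s" for s u
    unfolding X_def by (rule subgradient_iterate_cong) simp
  have "(\<integral>\<^sup>+\<omega>. f (X (\<lambda>i\<in>{..t}. \<xi> i \<omega>)) ((\<lambda>i\<in>{..t}. \<xi> i \<omega>) t) \<partial>P)
      = (\<integral>\<^sup>+s. (\<integral>\<^sup>+u. f (X (s(t := u))) ((s(t := u)) t) \<partial>\<pi>) \<partial>(\<Pi>\<^sub>M i\<in>{..<t}. \<pi>))"
    by (rule nn_integral_samples_PiM[OF iid \<pi> t]) measurable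
  \<comment> \<open>In this second use the split-off coordinate \<open>u'\<close> is a dummy:
    \<open>X\<close> ignores it and \<open>\<pi>\<close> has total mass one.\<close>
  moreover have "(\<integral>\<^sup>+\<omega>. (\<integral>\<^sup>+u. f (X (\<lambda>i\<in>{..t}. \<xi> i \<omega>)) u \<partial>\<pi>) \<partial>P)
      = (\<integral>\<^sup>+s. (\<integral>\<^sup>+u'. (\<integral>\<^sup>+u. f (X (s(t := u'))) u \<partial>\<pi>) \<partial>\<pi>) \<partial>(\<Pi>\<^sub>M i\<in>{..<t}. \<pi>))"
    by (rule nn_integral_samples_PiM[OF iid \<pi> t]) measurable
  ultimately show ?thesis
    by (simp add: X_eq X_upd \<pi>.emeasure_space_1)
qed

text \<open>The indicator is a function of \<open>tstar\<close> and the other factor a function of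
  the joint sample, so independence factorizes the integral.\<close>

lemma nn_integral_output_index:
  fixes g :: "'a::euclidean_space \<Rightarrow> 'w \<Rightarrow> 'a"
  assumes iid: "iid_samples P \<pi> \<xi> T" and t: "t \<le> T"
    and out: "output_index P \<pi> \<xi> \<gamma> T tstar"
    and g: "(\<lambda>(x, u). g x u) \<in> borel_measurable (borel \<Otimes>\<^sub>M \<pi>)"
    and f[measurable]: "f \<in> borel_measurable borel"
  shows "(\<integral>\<^sup>+\<omega>. indicator {t} (tstar \<omega>) * f (subgradient_iterate g \<gamma> x0 \<xi> t \<omega>) \<partial>P)
    = ennreal (\<gamma> t / (\<Sum>s\<le>T. \<gamma> s)) * (\<integral>\<^sup>+\<omega>. f (subgradient_iterate g \<gamma> x0 \<xi> t \<omega>) \<partial>P)"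
proof -
  interpret P: prob_space P using iid by (simp add: iid_samples_def)
  define A :: "_ \<Rightarrow> ennreal" where "A \<omega> = indicator {t} (tstar \<omega>)" for \<omega>
  define B where "B \<omega> = f (subgradient_iterate g \<gamma> x0 \<xi> t \<omega>)" for \<omega>
  define J where "J = (\<lambda>\<omega>. \<lambda>i\<in>{..T}. \<xi> i \<omega>)"
  define VA where "VA = vimage_algebra (space P) tstar (count_space {..T})"
  define VB where "VB = vimage_algebra (space P) J (\<Pi>\<^sub>M i\<in>{..T}. \<pi>)"
  have ts[measurable]: "tstar \<in> measurable P (count_space {..T})"
    and ind: "P.indep_set (sets VA) (sets VB)"
    and prob: "measure P {\<omega> \<in> space P. tstar \<omega> = t} = \<gamma> t / (\<Sum>s\<le>T. \<gamma> s)"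
    using out t by (auto simp: output_index_def VA_def VB_def J_def)
  have \<xi>: "\<And>i. i \<le> T \<Longrightarrow> \<xi> i \<in> measurable P \<pi>"
    using iid by (auto simp: iid_samples_def P.indep_vars_def)
  have J: "J \<in> measurable P (\<Pi>\<^sub>M i\<in>{..T}. \<pi>)"
    unfolding J_def using \<xi> by (intro measurable_restrict) auto
  have "tstar \<in> measurable VA (count_space {..T})"
    unfolding VA_def using measurable_space[OF ts] by (intro measurable_vimage_algebra1) auto
  then have A: "A \<in> borel_measurable VA"
    unfolding A_def by (rule measurable_compose) simp
  have "J \<in> measurable VB (\<Pi>\<^sub>M i\<in>{..T}. \<pi>)"
    unfolding VB_def using measurable_space[OF J] by (intro measurable_vimage_algebra1) auto
  moreover have "(\<lambda>s. f (subgradient_iterate g \<gamma> x0 (\<lambda>i (s::nat \<Rightarrow> 'w). s i) t s)) \<in> borel_measurable (\<Pi>\<^sub>M i\<in>{..T}. \<pi>)"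
    using t by (intro measurable_compose[OF _ f] measurable_subgradient_iterate[OF g]) auto
  moreover have "B = (\<lambda>\<omega>. f (subgradient_iterate g \<gamma> x0 (\<lambda>i (s::nat \<Rightarrow> 'w). s i) t (J \<omega>)))"
    unfolding B_def J_def using t by (intro ext arg_cong[of _ _ f] subgradient_iterate_cong) simp
  ultimately have B: "B \<in> borel_measurable VB"
    using measurable_compose by blast
  have A'[measurable]: "A \<in> borel_measurable P"
    unfolding A_def using ts by (rule measurable_compose) simp
  have B'[measurable]: "B \<in> borel_measurable P"
    unfolding B_def using \<xi> t by (intro measurable_compose[OF _ f] measurable_subgradient_iterate[OF g]) auto
  have sub: "sigma_sets (space P) {X -` S \<inter> space P |S. S \<in> sets borel} \<subseteq> sets V"
    if "X \<in> borel_measurable V" "space V = space P" for X :: "_ \<Rightarrow> ennreal" and V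
  proof -
    have "{X -` S \<inter> space P |S. S \<in> sets borel} \<subseteq> sets V"
      using measurable_sets[OF that(1)] that(2) by auto
    from sets.sigma_sets_subset[OF this] show ?thesis
      by (simp add: that(2))
  qed
  \<comment> \<open>Both \<open>A\<close> and \<open>B\<close> take values in
    \<open>ennreal\<close>, so \<open>indep_var\<close> applies to them although
    \<open>tstar\<close> and the samples have different types.\<close>
  have "P.indep_var borel A borel B"
    unfolding P.indep_var_eq
  proof (intro conjI A' B')
    show "P.indep_set (sigma_sets (space P) {A -` S \<inter> space P |S. S \<in> sets borel})
        (sigma_sets (space P) {B -` S \<inter> space P |S. S \<in> sets borel})"
      unfolding P.indep_set_def
    proof (rule P.indep_sets_mono_sets[OF ind[unfolded P.indep_set_def]])
      fix b :: bool
      show "case_bool (sigma_sets (space P) {A -` S \<inter> space P |S. S \<in> sets borel})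
          (sigma_sets (space P) {B -` S \<inter> space P |S. S \<in> sets borel}) b \<subseteq> case_bool (sets VA) (sets VB) b"
        using sub[OF A] sub[OF B] by (cases b) (simp_all add: VA_def VB_def)
    qed
  qed
  then have "P.indep_vars (\<lambda>_. borel) (case_bool A B) UNIV"
    by (simp add: P.indep_var_def case_bool_if if_distrib cong: if_cong)
  then have "(\<integral>\<^sup>+\<omega>. (\<Prod>b\<in>UNIV. case_bool A B b \<omega>) \<partial>P) = (\<Prod>b\<in>UNIV. \<integral>\<^sup>+\<omega>. case_bool A B b \<omega> \<partial>P)"
    by (intro P.indep_vars_nn_integral) auto
  then have "(\<integral>\<^sup>+\<omega>. A \<omega> * B \<omega> \<partial>P) = (\<integral>\<^sup>+\<omega>. A \<omega> \<partial>P) * (\<integral>\<^sup>+\<omega>. B \<omega> \<partial>P)"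
    by (simp add: UNIV_bool mult.commute)
  moreover have "(\<integral>\<^sup>+\<omega>. A \<omega> \<partial>P) = (\<integral>\<^sup>+\<omega>. indicator {\<omega> \<in> space P. tstar \<omega> = t} \<omega> \<partial>P)"
    unfolding A_def by (intro nn_integral_cong) (auto split: split_indicator)
  moreover have "\<dots> = ennreal (\<gamma> t / (\<Sum>s\<le>T. \<gamma> s))"
    using prob by (subst nn_integral_indicator) (auto simp: P.emeasure_eq_measure)
  ultimately show ?thesis
    by (simp add: A_def B_def)
qed

subsection \<open>Expected descent\<close>

locale stochastic_subgradient_setting = moreau_envelope_setting F p r z
  for F :: "'a::euclidean_space \<Rightarrow> real" and p r z +
  fixes \<rho> L :: real and \<pi> :: "'w measure" and g :: "'a \<Rightarrow> 'w \<Rightarrow> 'a"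
  assumes p_le_2: "p \<le> 2" and \<rho>: "0 < \<rho>" and r_\<rho>: "r * \<rho> < 1"
    and pc: "paraconvex \<rho> p (\<lambda>x. ereal (F x))"
    and subgrad: "subgradient_oracle \<pi> g (\<lambda>x. ereal (F x)) p L"
begin

text \<open>Subtracting the minimum makes the quantity nonnegative, so its expectations can be taken
  as nonnegative integrals.\<close>

definition gap :: "'a \<Rightarrow> real" where
  "gap x = env x - F z"

definition dist2 :: "'a \<Rightarrow> ennreal" where
  "dist2 x = (set_distance 0 (limiting_subdiff (moreau_envelope p r (\<lambda>x. ereal (F x))) x))\<^sup>2"

text \<open>The remainder of the norm expansion for a step of size \<open>s\<close>, divided by
  \<open>r * p\<close>, with the \<open>p\<close>-th moment replaced by its bound.\<close>

definition noise :: "real \<Rightarrow> real" where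
  "noise s = (p + 1) * L powr p / (r * p) * s powr p"

definition next_gap :: "real \<Rightarrow> 'a \<Rightarrow> ennreal" where
  "next_gap s x = (\<integral>\<^sup>+u. ennreal (gap (x - s *\<^sub>R g x u)) \<partial>\<pi>)"

text \<open>
  A Borel function of the iterate that dominates \<open>dist2\<close> up to a constant. It is needed because
  \<open>dist2\<close> is not known to be measurable, and \<open>nn_integral\<close> of a non-measurable function is a lower
  integral, which is monotone but not additive.
\<close>

definition decrease :: "real \<Rightarrow> 'a \<Rightarrow> ennreal" where
  "decrease s x = ennreal (gap x) + ennreal (noise s) - next_gap s x"

section \<open>Measurability and moments\<close>

lemma gap_nonneg: "0 \<le> gap x"
  using env_ge by (simp add: gap_def)

lemma noise_nonneg: "0 \<le> noise s"
  using p r by (simp add: noise_def)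

lemma prob_space_\<pi>: "prob_space \<pi>"
  using subgrad by (simp add: subgradient_oracle_def)

lemma measurable_g: "(\<lambda>(x, u). g x u) \<in> borel_measurable (borel \<Otimes>\<^sub>M \<pi>)"
  using subgrad by (simp add: subgradient_oracle_def)

lemma measurable_g_section: "g x \<in> borel_measurable \<pi>"
  using measurable_compose[OF measurable_Pair1' measurable_g, of x] by simp

lemma measurable_gap [measurable]: "gap \<in> borel_measurable borel"
  unfolding gap_def by (intro borel_measurable_continuous_onI continuous_intros continuous_env)

lemma measurable_gap_step:
  "(\<lambda>(x, u). ennreal (gap (x - s *\<^sub>R g x u))) \<in> borel_measurable (borel \<Otimes>\<^sub>M \<pi>)"
proof -
  note measurable_g[measurable]
  show ?thesis by measurable
qed

lemma measurable_next_gap [measurable]: "next_gap s \<in> borel_measurable borel"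
proof -
  interpret prob_space \<pi> by (rule prob_space_\<pi>)
  show ?thesis
    unfolding next_gap_def using measurable_gap_step[of s] by measurable
qed

lemma measurable_decrease [measurable]: "decrease s \<in> borel_measurable borel"
  unfolding decrease_def by measurable

lemma moment_bound:
  "integrable \<pi> (\<lambda>u. norm (g x u) powr p)"
  "(\<integral>u. norm (g x u) powr p \<partial>\<pi>) \<le> L powr p"
proof -
  have le: "(\<integral>\<^sup>+u. ennreal (norm (g x u) powr p) \<partial>\<pi>) \<le> ennreal (L powr p)"
    using subgrad by (simp add: subgradient_oracle_def)
  note measurable_g_section[measurable]
  show int: "integrable \<pi> (\<lambda>u. norm (g x u) powr p)"
    using le by (intro integrableI_nonneg) (auto simp: top_unique less_top intro: le_less_trans)
  show "(\<integral>u. norm (g x u) powr p \<partial>\<pi>) \<le> L powr p"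
    using le nn_integral_eq_integral[OF int] by (simp add: ennreal_le_iff)
qed

lemma integrable_g: "integrable \<pi> (g x)"
proof -
  interpret prob_space \<pi> by (rule prob_space_\<pi>)
  have "integrable \<pi> (\<lambda>u. 1 + norm (g x u) powr p)"
    using moment_bound by auto
  then show ?thesis
  proof (rule Bochner_Integration.integrable_bound[OF _ measurable_g_section], intro AE_I2)
    fix u
    have "norm (g x u) \<le> 1 + norm (g x u) powr p"
    proof (cases "norm (g x u) \<le> 1")
      case False
      then have "norm (g x u) powr 1 \<le> norm (g x u) powr p"
        using p by (intro powr_mono) auto
      then show ?thesis by simp
    qed (simp add: add_increasing2)
    then show "norm (g x u) \<le> norm (1 + norm (g x u) powr p)" by simp
  qed
qed

section \<open>Descent in one step\<close>

text \<open>A limiting subgradient of controlled norm exists, so the infimum is not over the empty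
  set. The bound comes with a particular proximal point, which \<open>descent\<close> then
  uses.\<close>

lemma prox_dist2_le:
  "\<exists>y\<in>prox x. dist2 x \<le> ennreal ((1 / r * norm (x - y) powr (p - 1))\<^sup>2)"
proof -
  obtain y v where y: "y \<in> prox x" and v: "v \<in> limiting_subdiff (\<lambda>x. ereal (env x)) x"
    and le: "norm v \<le> 1 / r * norm (x - y) powr (p - 1)"
    using limiting_subgradient_exists by blast
  have "set_distance 0 (limiting_subdiff (moreau_envelope p r (\<lambda>x. ereal (F x))) x) \<le> ennreal (dist 0 v)"
    unfolding set_distance_def moreau_envelope_eq using v by (rule INF_lower)
  also have "\<dots> \<le> ennreal (1 / r * norm (x - y) powr (p - 1))"
    using le by (simp add: ennreal_leI)
  finally have "dist2 x \<le> (ennreal (1 / r * norm (x - y) powr (p - 1)))\<^sup>2"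
    unfolding dist2_def by (intro power_mono) auto
  also have "\<dots> = ennreal ((1 / r * norm (x - y) powr (p - 1))\<^sup>2)"
    using r by (intro ennreal_power) auto
  finally show ?thesis using y by blast
qed

lemma mean_inner_ge:
  assumes "y \<in> prox x"
  shows "(1 - r * \<rho>) / (r * p) * norm (x - y) powr p \<le> inner (x - y) (\<integral>u. g x u \<partial>\<pi>)"
proof -
  have "(\<integral>u. g x u \<partial>\<pi>) \<in> limiting_subdiff (\<lambda>x. ereal (F x)) x"
    using subgrad by (simp add: subgradient_oracle_def)
  then have "F x + inner (\<integral>u. g x u \<partial>\<pi>) (y - x) - \<rho> / p * norm (y - x) powr p \<le> F y"
    using p \<rho> by (intro paraconvex_subgradient_inequality[OF pc]) auto
  moreover have "inner (\<integral>u. g x u \<partial>\<pi>) (y - x) = - inner (x - y) (\<integral>u. g x u \<partial>\<pi>)"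
    by (simp add: inner_diff inner_commute)
  \<comment> \<open>The point \<open>x\<close> is itself a competitor, with zero penalty and cost
    \<open>F x\<close>.\<close>
  moreover have "F y + 1 / (r * p) * norm (x - y) powr p \<le> F x"
    using env_le_cost[of x x] env_eq_cost[OF assms] p by (simp add: cost_def)
  moreover have "(1 - r * \<rho>) / (r * p) * norm (x - y) powr p
      = 1 / (r * p) * norm (x - y) powr p - \<rho> / p * norm (x - y) powr p"
    using p r by (simp add: field_simps)
  ultimately show ?thesis
    by (simp add: norm_minus_commute)
qed

text \<open>Stated as a sum on the left because subtraction in \<open>ennreal\<close> is
  truncated.\<close>

lemma descent:
  assumes s: "0 < s"
  shows "ennreal (s * (1 - r * \<rho>) / p) * dist2 x + next_gap s x \<le> ennreal (gap x) + ennreal (noise s)"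
proof -
  interpret prob_space \<pi> by (rule prob_space_\<pi>)
  obtain y where y: "y \<in> prox x" and d: "dist2 x \<le> ennreal ((1 / r * norm (x - y) powr (p - 1))\<^sup>2)"
    using prox_dist2_le by blast
  define a where "a = x - y"
  \<comment> \<open>With \<open>b = - s *\<^sub>R g x u\<close> in the norm expansion,
    \<open>w\<close> and \<open>k\<close> collect the coefficients after division by
    \<open>r * p\<close>; \<open>D\<close> is the guaranteed mean decrease and \<open>U\<close> the
    pathwise bound on the next gap.\<close>
  define w where "w = s / r * norm a powr (p - 2)"
  define k where "k = (p + 1) / (r * p) * s powr p"
  define m where "m = (\<integral>u. g x u \<partial>\<pi>)"
  define D where "D = s * (1 - r * \<rho>) / p * (1 / r * norm a powr (p - 1))\<^sup>2"
  define U where "U u = gap x - w * inner a (g x u) + k * norm (g x u) powr p" for u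
  have w: "0 \<le> w" and k: "0 \<le> k"
    using s r p by (simp_all add: w_def k_def)
  have D0: "0 \<le> D" using s r_\<rho> p by (simp add: D_def)
  have U: "gap (x - s *\<^sub>R g x u) \<le> U u" for u
  proof -
    have "env (x - s *\<^sub>R g x u) \<le> F y + 1 / (r * p) * norm (a + (- s *\<^sub>R g x u)) powr p"
      using env_le_cost[of "x - s *\<^sub>R g x u" y] by (simp add: cost_def a_def algebra_simps)
    also have "1 / (r * p) * norm (a + (- s *\<^sub>R g x u)) powr p
        \<le> 1 / (r * p) * (norm a powr p + p * norm a powr (p - 2) * inner a (- s *\<^sub>R g x u)
            + (p + 1) * norm (- s *\<^sub>R g x u) powr p)"
      using p r p_le_2 by (intro mult_left_mono norm_add_powr_le) auto
    also have "norm (- s *\<^sub>R g x u) powr p = s powr p * norm (g x u) powr p"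
      using s by (simp add: powr_mult)
    also have "1 / (r * p) * (norm a powr p + p * norm a powr (p - 2) * inner a (- s *\<^sub>R g x u)
            + (p + 1) * (s powr p * norm (g x u) powr p))
        = 1 / (r * p) * norm a powr p - w * inner a (g x u) + k * norm (g x u) powr p"
      using p r by (simp add: w_def k_def field_simps)
    finally show ?thesis
      using env_eq_cost[OF y] by (simp add: U_def gap_def cost_def a_def)
  qed
  have intU: "integrable \<pi> U"
    unfolding U_def using moment_bound integrable_g
    by (intro Bochner_Integration.integrable_add Bochner_Integration.integrable_diff
        integrable_mult_right integrable_inner_right) auto
  have "(\<integral>u. U u \<partial>\<pi>) = gap x - w * inner a m + k * (\<integral>u. norm (g x u) powr p \<partial>\<pi>)"
    unfolding U_def m_def using moment_bound integrable_g
    by (simp add: prob_space)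
  also have "k * (\<integral>u. norm (g x u) powr p \<partial>\<pi>) \<le> k * L powr p"
    using k by (intro mult_left_mono moment_bound)
  also have "k * L powr p = noise s"
    by (simp add: k_def noise_def)
  also have "gap x - w * inner a m \<le> gap x - D"
  proof -
    have "w * ((1 - r * \<rho>) / (r * p) * norm a powr p) \<le> w * inner a m"
      using w mean_inner_ge[OF y] by (intro mult_left_mono) (auto simp: a_def m_def)
    \<comment> \<open>The exponents \<open>p - 2\<close> from the expansion and \<open>p\<close>
      from \<open>mean_inner_ge\<close> add up to the \<open>2 * (p - 1)\<close> of the squared
      subgradient bound.\<close>
    moreover have "norm a powr (p - 2) * norm a powr p = (norm a powr (p - 1))\<^sup>2"
      by (simp add: power2_eq_square flip: powr_add)
    then have "w * ((1 - r * \<rho>) / (r * p) * norm a powr p)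
        = s * (1 - r * \<rho>) / (r\<^sup>2 * p) * (norm a powr (p - 1))\<^sup>2"
      unfolding w_def by (simp add: power2_eq_square mult.assoc mult.left_commute)
    then have "w * ((1 - r * \<rho>) / (r * p) * norm a powr p) = D"
      by (simp add: D_def power_mult_distrib power_divide mult.commute)
    ultimately show ?thesis by simp
  qed
  finally have int_le: "(\<integral>u. U u \<partial>\<pi>) \<le> gap x - D + noise s" by simp
  have U_nonneg: "0 \<le> U u" for u
    using U[of u] gap_nonneg[of "x - s *\<^sub>R g x u"] by linarith
  have "next_gap s x \<le> (\<integral>\<^sup>+u. ennreal (U u) \<partial>\<pi>)"
    unfolding next_gap_def using U by (intro nn_integral_mono ennreal_leI)
  also have "\<dots> = ennreal (\<integral>u. U u \<partial>\<pi>)"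
    using U_nonneg by (intro nn_integral_eq_integral intU) auto
  finally have "next_gap s x \<le> ennreal (\<integral>u. U u \<partial>\<pi>)" .
  moreover have "ennreal (s * (1 - r * \<rho>) / p) * dist2 x
      \<le> ennreal (s * (1 - r * \<rho>) / p) * ennreal ((1 / r * norm a powr (p - 1))\<^sup>2)"
    using d by (intro mult_left_mono) (auto simp: a_def)
  moreover have "\<dots> = ennreal D"
    unfolding D_def using s r_\<rho> p by (intro ennreal_mult[symmetric]) auto
  ultimately have "ennreal (s * (1 - r * \<rho>) / p) * dist2 x + next_gap s x
      \<le> ennreal D + ennreal (\<integral>u. U u \<partial>\<pi>)"
    by (intro add_mono) auto
  also have "\<dots> = ennreal (D + (\<integral>u. U u \<partial>\<pi>))"
    using D0 U_nonneg by (intro ennreal_plus[symmetric] integral_nonneg) auto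
  also have "\<dots> \<le> ennreal (gap x + noise s)"
    using int_le by (intro ennreal_leI) simp
  also have "\<dots> = ennreal (gap x) + ennreal (noise s)"
    using gap_nonneg noise_nonneg by (intro ennreal_plus)
  finally show ?thesis .
qed

text \<open>Ensures that the subtraction in \<open>decrease\<close> is not truncated, so adding
  \<open>next_gap\<close> undoes it.\<close>

lemma next_gap_le: "0 < s \<Longrightarrow> next_gap s x \<le> ennreal (gap x) + ennreal (noise s)"
  using descent[of s x] by (rule order_trans[rotated]) (auto intro: add_increasing)

lemma dist2_le_decrease:
  assumes "0 < s"
  shows "ennreal s * dist2 x \<le> ennreal (p / (1 - r * \<rho>)) * decrease s x"
proof -
  have "ennreal (s * (1 - r * \<rho>) / p) * dist2 x \<le> decrease s x"
    using descent[OF assms, of x] unfolding decrease_def ennreal_le_minus_iff ..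
  then have "ennreal (p / (1 - r * \<rho>)) * (ennreal (s * (1 - r * \<rho>) / p) * dist2 x)
      \<le> ennreal (p / (1 - r * \<rho>)) * decrease s x"
    by (intro mult_left_mono) auto
  moreover have "ennreal (p / (1 - r * \<rho>)) * ennreal (s * (1 - r * \<rho>) / p) = ennreal s"
    using assms p r_\<rho> by (simp flip: ennreal_mult)
  ultimately show ?thesis
    by (simp flip: mult.assoc)
qed

section \<open>Summation along the iterates\<close>

context
  fixes P :: "'s measure" and \<xi> :: "nat \<Rightarrow> 's \<Rightarrow> 'w" and \<gamma> :: "nat \<Rightarrow> real" and x0 :: 'a and T :: nat
  assumes iid: "iid_samples P \<pi> \<xi> T" and \<gamma>_pos: "\<And>t. t \<le> T \<Longrightarrow> 0 < \<gamma> t"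
begin

abbreviation "xs \<equiv> subgradient_iterate g \<gamma> x0 \<xi>"

lemma measurable_iterate: "t \<le> Suc T \<Longrightarrow> xs t \<in> borel_measurable P"
proof -
  interpret P: prob_space P using iid by (simp add: iid_samples_def)
  show "t \<le> Suc T \<Longrightarrow> xs t \<in> borel_measurable P"
    using iid by (intro measurable_subgradient_iterate[OF measurable_g])
      (auto simp: iid_samples_def P.indep_vars_def)
qed

text \<open>Telescoping with the last gap kept on the left, so that nothing is subtracted. The index
  reaches \<open>Suc T\<close> because sample \<open>T\<close> still produces an iterate.\<close>

lemma sum_decrease_telescope:
  "n \<le> Suc T \<Longrightarrow> (\<Sum>t<n. \<integral>\<^sup>+\<omega>. decrease (\<gamma> t) (xs t \<omega>) \<partial>P) + (\<integral>\<^sup>+\<omega>. ennreal (gap (xs n \<omega>)) \<partial>P)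
    = ennreal (gap x0) + (\<Sum>t<n. ennreal (noise (\<gamma> t)))"
proof (induction n)
  case 0
  interpret P: prob_space P using iid by (simp add: iid_samples_def)
  show ?case by (simp add: P.emeasure_space_1)
next
  case (Suc n)
  interpret P: prob_space P using iid by (simp add: iid_samples_def)
  have n: "n \<le> T" using Suc by simp
  note [measurable] = measurable_iterate[of n, OF le_SucI[OF n]]
  have "(\<integral>\<^sup>+\<omega>. decrease (\<gamma> n) (xs n \<omega>) \<partial>P) + (\<integral>\<^sup>+\<omega>. ennreal (gap (xs (Suc n) \<omega>)) \<partial>P)
      = (\<integral>\<^sup>+\<omega>. decrease (\<gamma> n) (xs n \<omega>) \<partial>P) + (\<integral>\<^sup>+\<omega>. next_gap (\<gamma> n) (xs n \<omega>) \<partial>P)"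
    using nn_integral_iterate_sample[OF iid prob_space_\<pi> n measurable_g measurable_gap_step]
    by (simp add: next_gap_def)
  also have "\<dots> = (\<integral>\<^sup>+\<omega>. decrease (\<gamma> n) (xs n \<omega>) + next_gap (\<gamma> n) (xs n \<omega>) \<partial>P)"
    by (intro nn_integral_add[symmetric]) measurable
  also have "\<dots> = (\<integral>\<^sup>+\<omega>. ennreal (gap (xs n \<omega>)) + ennreal (noise (\<gamma> n)) \<partial>P)"
    unfolding decrease_def using next_gap_le[OF \<gamma>_pos[OF n]]
    by (intro nn_integral_cong diff_add_cancel_ennreal)
  also have "\<dots> = (\<integral>\<^sup>+\<omega>. ennreal (gap (xs n \<omega>)) \<partial>P) + ennreal (noise (\<gamma> n))"
    by (subst nn_integral_add) (auto simp: P.emeasure_space_1)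
  finally have step: "(\<integral>\<^sup>+\<omega>. decrease (\<gamma> n) (xs n \<omega>) \<partial>P) + (\<integral>\<^sup>+\<omega>. ennreal (gap (xs (Suc n) \<omega>)) \<partial>P)
      = (\<integral>\<^sup>+\<omega>. ennreal (gap (xs n \<omega>)) \<partial>P) + ennreal (noise (\<gamma> n))" .
  have IH: "(\<Sum>t<n. \<integral>\<^sup>+\<omega>. decrease (\<gamma> t) (xs t \<omega>) \<partial>P) + (\<integral>\<^sup>+\<omega>. ennreal (gap (xs n \<omega>)) \<partial>P)
      = ennreal (gap x0) + (\<Sum>t<n. ennreal (noise (\<gamma> t)))"
    using Suc by simp
  show ?case
    unfolding sum.lessThan_Suc add.assoc step
    unfolding add.assoc[symmetric] IH ..
qed

lemma sum_decrease_le: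
  "(\<Sum>t\<le>T. \<integral>\<^sup>+\<omega>. decrease (\<gamma> t) (xs t \<omega>) \<partial>P) \<le> ennreal (gap x0 + (\<Sum>t\<le>T. noise (\<gamma> t)))"
proof -
  have "(\<Sum>t\<le>T. \<integral>\<^sup>+\<omega>. decrease (\<gamma> t) (xs t \<omega>) \<partial>P) \<le> ennreal (gap x0) + (\<Sum>t\<le>T. ennreal (noise (\<gamma> t)))"
    unfolding lessThan_Suc_atMost[symmetric] sum_decrease_telescope[OF order_refl, symmetric]
    by (simp add: add_increasing2)
  also have "\<dots> = ennreal (gap x0 + (\<Sum>t\<le>T. noise (\<gamma> t)))"
    using gap_nonneg noise_nonneg by (simp add: sum_ennreal ennreal_plus sum_nonneg)
  finally show ?thesis .
qed

lemma weighted_dist2_bound: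
  "(\<integral>\<^sup>+\<omega>. (\<Sum>t\<le>T. ennreal (\<gamma> t) * dist2 (xs t \<omega>)) \<partial>P)
    \<le> ennreal (p / (1 - r * \<rho>) * (gap x0 + (\<Sum>t\<le>T. noise (\<gamma> t))))"
proof -
  let ?c = "p / (1 - r * \<rho>)"
  have meas: "\<And>t. t \<le> T \<Longrightarrow> (\<lambda>\<omega>. decrease (\<gamma> t) (xs t \<omega>)) \<in> borel_measurable P"
    by (intro measurable_compose[OF measurable_iterate measurable_decrease]) auto
  \<comment> \<open>Monotonicity replaces \<open>dist2\<close> by the measurable
    \<open>decrease\<close> before sum and integral are exchanged.\<close>
  have "(\<integral>\<^sup>+\<omega>. (\<Sum>t\<le>T. ennreal (\<gamma> t) * dist2 (xs t \<omega>)) \<partial>P)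
      \<le> (\<integral>\<^sup>+\<omega>. (\<Sum>t\<le>T. ennreal ?c * decrease (\<gamma> t) (xs t \<omega>)) \<partial>P)"
    using \<gamma>_pos by (intro nn_integral_mono sum_mono dist2_le_decrease) auto
  also have "\<dots> = ennreal ?c * (\<Sum>t\<le>T. \<integral>\<^sup>+\<omega>. decrease (\<gamma> t) (xs t \<omega>) \<partial>P)"
    using meas by (subst nn_integral_sum) (auto simp: nn_integral_cmult sum_distrib_left)
  also have "\<dots> \<le> ennreal ?c * ennreal (gap x0 + (\<Sum>t\<le>T. noise (\<gamma> t)))"
    by (intro mult_left_mono sum_decrease_le) auto
  also have "\<dots> = ennreal (?c * (gap x0 + (\<Sum>t\<le>T. noise (\<gamma> t))))"
    using p r_\<rho> by (intro ennreal_mult'[symmetric]) auto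
  finally show ?thesis .
qed

text \<open>Splitting by the value of \<open>tstar\<close>, the factor \<open>1 / \<gamma> t\<close>
  needed to bound \<open>dist2\<close> by \<open>decrease\<close> cancels against the probability
  \<open>\<gamma> t / (\<Sum>s\<le>T. \<gamma> s)\<close>.\<close>

lemma output_dist2_bound:
  assumes out: "output_index P \<pi> \<xi> \<gamma> T tstar"
  shows "(\<integral>\<^sup>+\<omega>. dist2 (xs (tstar \<omega>) \<omega>) \<partial>P)
    \<le> ennreal (p / (1 - r * \<rho>) * (gap x0 + (\<Sum>t\<le>T. noise (\<gamma> t))) / (\<Sum>t\<le>T. \<gamma> t))"
proof -
  define c where "c = p / (1 - r * \<rho>)"
  let ?S = "\<Sum>t\<le>T. \<gamma> t"
  have c: "c > 0" using p r_\<rho> by (simp add: c_def)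
  have S: "?S > 0" using \<gamma>_pos by (intro sum_pos) auto
  have meas: "\<And>t. t \<le> T \<Longrightarrow> (\<lambda>\<omega>. decrease (\<gamma> t) (xs t \<omega>)) \<in> borel_measurable P"
    by (intro measurable_compose[OF measurable_iterate measurable_decrease]) auto
  have ts: "tstar \<in> measurable P (count_space {..T})"
    using out by (simp add: output_index_def)
  have meas': "(\<lambda>\<omega>. indicator {t} (tstar \<omega>) * decrease (\<gamma> t) (xs t \<omega>)) \<in> borel_measurable P" if "t \<le> T" for t
    by (intro borel_measurable_times_ennreal meas that measurable_compose[OF ts]) auto
  \<comment> \<open>Only the summand with \<open>t = tstar \<omega>\<close> is nonzero; the sum
    makes the index deterministic.\<close>
  have "(\<integral>\<^sup>+\<omega>. dist2 (xs (tstar \<omega>) \<omega>) \<partial>P)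
      \<le> (\<integral>\<^sup>+\<omega>. (\<Sum>t\<le>T. ennreal (c / \<gamma> t) * (indicator {t} (tstar \<omega>) * decrease (\<gamma> t) (xs t \<omega>))) \<partial>P)"
  proof (rule nn_integral_mono)
    fix \<omega> assume "\<omega> \<in> space P"
    then have t: "tstar \<omega> \<le> T"
      using measurable_space[OF ts] by auto
    define t where "t = tstar \<omega>"
    have pos: "\<gamma> t > 0" using \<gamma>_pos t by (simp add: t_def)
    have "dist2 (xs t \<omega>) = ennreal (1 / \<gamma> t) * (ennreal (\<gamma> t) * dist2 (xs t \<omega>))"
      using pos by (simp flip: mult.assoc ennreal_mult)
    also have "\<dots> \<le> ennreal (1 / \<gamma> t) * (ennreal c * decrease (\<gamma> t) (xs t \<omega>))"
      by (intro mult_left_mono dist2_le_decrease[folded c_def] pos) auto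
    also have "\<dots> = ennreal (c / \<gamma> t) * (indicator {t} (tstar \<omega>) * decrease (\<gamma> t) (xs t \<omega>))"
    proof -
      have "ennreal (1 / \<gamma> t) * ennreal c = ennreal (c / \<gamma> t)"
        using pos c by (simp add: mult.commute flip: ennreal_mult)
      then show ?thesis
        by (simp add: t_def flip: mult.assoc)
    qed
    also have "\<dots> \<le> (\<Sum>t\<le>T. ennreal (c / \<gamma> t) * (indicator {t} (tstar \<omega>) * decrease (\<gamma> t) (xs t \<omega>)))"
      using t by (intro member_le_sum) (auto simp: t_def)
    finally show "dist2 (xs (tstar \<omega>) \<omega>)
        \<le> (\<Sum>t\<le>T. ennreal (c / \<gamma> t) * (indicator {t} (tstar \<omega>) * decrease (\<gamma> t) (xs t \<omega>)))"
      by (simp add: t_def)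
  qed
  also have "\<dots> = (\<Sum>t\<le>T. ennreal (c / \<gamma> t) * (\<integral>\<^sup>+\<omega>. indicator {t} (tstar \<omega>) * decrease (\<gamma> t) (xs t \<omega>) \<partial>P))"
    using meas' by (subst nn_integral_sum) (auto simp: nn_integral_cmult)
  also have "\<dots> = (\<Sum>t\<le>T. ennreal (c / ?S) * (\<integral>\<^sup>+\<omega>. decrease (\<gamma> t) (xs t \<omega>) \<partial>P))"
  proof (rule sum.cong[OF refl])
    fix t assume "t \<in> {..T}"
    then have t: "t \<le> T" by simp
    have "ennreal (c / \<gamma> t) * ennreal (\<gamma> t / ?S) = ennreal (c / ?S)"
      using \<gamma>_pos[OF t] S c by (subst ennreal_mult[symmetric]) auto
    then show "ennreal (c / \<gamma> t) * (\<integral>\<^sup>+\<omega>. indicator {t} (tstar \<omega>) * decrease (\<gamma> t) (xs t \<omega>) \<partial>P)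
        = ennreal (c / ?S) * (\<integral>\<^sup>+\<omega>. decrease (\<gamma> t) (xs t \<omega>) \<partial>P)"
      unfolding nn_integral_output_index[OF iid t out measurable_g measurable_decrease]
      by (simp flip: mult.assoc)
  qed
  also have "\<dots> = ennreal (c / ?S) * (\<Sum>t\<le>T. \<integral>\<^sup>+\<omega>. decrease (\<gamma> t) (xs t \<omega>) \<partial>P)"
    by (simp add: sum_distrib_left)
  also have "\<dots> \<le> ennreal (c / ?S) * ennreal (gap x0 + (\<Sum>t\<le>T. noise (\<gamma> t)))"
    by (intro mult_left_mono sum_decrease_le) auto
  also have "\<dots> = ennreal (c / ?S * (gap x0 + (\<Sum>t\<le>T. noise (\<gamma> t))))"
    using c S by (intro ennreal_mult'[symmetric]) auto
  finally show ?thesis by (simp add: c_def)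
qed

end

end

subsection \<open>Step sizes and the convergence rate\<close>

text \<open>A discrete form of comparison with the integral: the tangent of the concave power
  \<open>1 - 1 / p\<close> at \<open>t + 1\<close> bounds its increment up to \<open>t + 2\<close>,
  and the increments telescope from \<open>1\<close> to \<open>T + 2\<close>.\<close>

lemma sum_powr_minus_ge:
  assumes "1 < p"
  shows "p / (p - 1) * ((real T + 2) powr (1 - 1 / p) - 1) \<le> (\<Sum>t\<le>T. (real t + 1) powr (- 1 / p))"
proof -
  have "(real T + 2) powr (1 - 1 / p) - 1 \<le> (1 - 1 / p) * (\<Sum>t\<le>T. (real t + 1) powr (- 1 / p))"
  proof (induction T)
    case 0
    show ?case
      using powr_le_tangent[of 2 1 "1 - 1 / p"] assms by simp
  next
    case (Suc T)
    have "(real T + 3) powr (1 - 1 / p) \<le> (real T + 2) powr (1 - 1 / p) + (1 - 1 / p) * (real T + 2) powr (- 1 / p)"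
      using powr_le_tangent[of "real T + 3" "real T + 2" "1 - 1 / p"] assms by simp
    then show ?case
      using Suc by (simp add: distrib_left add.commute)
  qed
  then have "p / (p - 1) * ((real T + 2) powr (1 - 1 / p) - 1)
      \<le> p / (p - 1) * ((1 - 1 / p) * (\<Sum>t\<le>T. (real t + 1) powr (- 1 / p)))"
    using assms by (intro mult_left_mono) auto
  also have "p / (p - 1) * (1 - 1 / p) = 1"
    using assms by (simp add: field_simps)
  then have "p / (p - 1) * ((1 - 1 / p) * (\<Sum>t\<le>T. (real t + 1) powr (- 1 / p))) = (\<Sum>t\<le>T. (real t + 1) powr (- 1 / p))"
    by (simp only: mult.assoc[symmetric] mult_1_left)
  finally show ?thesis .
qed

lemma sum_powr_minus_powr_le:
  assumes "p \<noteq> 0"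
  shows "(\<Sum>t\<le>T. ((real t + 1) powr (- 1 / p)) powr p) \<le> ln (real T + 1) + 1"
proof -
  have "((real t + 1) powr (- 1 / p)) powr p = (real t + 1) powr (- 1)" for t
    using assms by (simp only: powr_powr) simp
  then have "((real t + 1) powr (- 1 / p)) powr p = inverse (real (Suc t))" for t
    by (simp add: powr_minus add.commute)
  then have "(\<Sum>t\<le>T. ((real t + 1) powr (- 1 / p)) powr p) = harm (Suc T)"
    unfolding harm_def atMost_atLeast0 One_nat_def sum.shift_bounds_cl_Suc_ivl by (simp del: of_nat_Suc)
  also have "harm (Suc T) \<le> ln (real T + 1) + (1::real)"
    \<comment> \<open>The difference between harmonic sum and logarithm is nonincreasing and starts
      at \<open>1\<close>.\<close>
    using decseqD[OF decseq_harm_diff_ln, of 0 T] by (simp add: harm_expand add.commute)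
  finally show ?thesis .
qed

lemma enn2ereal_le_ereal: "x \<le> ennreal b \<Longrightarrow> 0 \<le> b \<Longrightarrow> enn2ereal x \<le> ereal b"
  by (simp add: less_eq_ennreal.rep_eq)

context stochastic_subgradient_setting
begin

text \<open>The expansion gives the constant \<open>p + 1\<close>, which is relaxed here using
  \<open>2 powr (p - 1) \<ge> 1\<close>; the factor \<open>p\<close> cancels the one in the
  denominator of \<open>noise\<close>.\<close>

lemma sum_noise_le:
  "p / (1 - r * \<rho>) * (\<Sum>t\<le>T. noise (\<gamma> t))
    \<le> (2 powr (p - 1) * p + 1) * L powr p / (r * (1 - r * \<rho>)) * (\<Sum>t\<le>T. \<gamma> t powr p)"
proof -
  have "1 * p \<le> 2 powr (p - 1) * p"
    using p by (intro mult_right_mono ge_one_powr_ge_zero) auto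
  then have "(p + 1) * (L powr p / (r * (1 - r * \<rho>)) * (\<Sum>t\<le>T. \<gamma> t powr p))
      \<le> (2 powr (p - 1) * p + 1) * (L powr p / (r * (1 - r * \<rho>)) * (\<Sum>t\<le>T. \<gamma> t powr p))"
    using r r_\<rho> by (intro mult_right_mono mult_nonneg_nonneg sum_nonneg) auto
  moreover have "p / d * ((p + 1) * L powr p / (r * p) * S) = (p + 1) * (L powr p / (r * d) * S)" for d S
    using p by simp
  then have "p / (1 - r * \<rho>) * (\<Sum>t\<le>T. noise (\<gamma> t))
      = (p + 1) * (L powr p / (r * (1 - r * \<rho>)) * (\<Sum>t\<le>T. \<gamma> t powr p))"
    unfolding noise_def sum_distrib_left[symmetric] .
  ultimately show ?thesis
    by simp
qed

end

theorem theorem3p1: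
  fixes F :: "real ^ 'n \<Rightarrow> real"
    and g :: "real ^ 'n \<Rightarrow> 'w \<Rightarrow> real ^ 'n"
    and \<pi> :: "'w measure" and P :: "'s measure"
    and \<xi> :: "nat \<Rightarrow> 's \<Rightarrow> 'w"
    and \<gamma> :: "nat \<Rightarrow> real" and x0 :: "real ^ 'n"
    and p \<rho> L :: real and T :: nat
  assumes "1 < p" and "p \<le> 2" and "\<rho> > 0"
    and "lower_semicontinuous (\<lambda>x. ereal (F x))"
    and "paraconvex \<rho> p (\<lambda>x. ereal (F x))"
    and min_exists: "\<exists>z. \<forall>y. F z \<le> F y"
    and "subgradient_oracle \<pi> g (\<lambda>x. ereal (F x)) p L"
    and "iid_samples P \<pi> \<xi> T"
    and "\<forall>t\<le>T. \<gamma> t > 0"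
  shows
    "(\<forall>r. 0 < r \<and> r < 1 / (2 powr (p - 1) * \<rho>) \<longrightarrow>
        enn2ereal (\<integral>\<^sup>+\<omega>. (\<Sum>t\<le>T. ennreal (\<gamma> t) *
            (set_distance 0 (limiting_subdiff (moreau_envelope p r (\<lambda>x. ereal (F x)))
               (subgradient_iterate g \<gamma> x0 \<xi> t \<omega>)))\<^sup>2) \<partial>P)
        \<le> ereal (p / (1 - r * \<rho>)) *
             (moreau_envelope p r (\<lambda>x. ereal (F x)) x0 - ereal (INF x. F x))
           + ereal ((2 powr (p - 1) * p + 1) * L powr p / (r * (1 - r * \<rho>)) *
               (\<Sum>t\<le>T. \<gamma> t powr p)))
     \<and>
     ((\<forall>t\<le>T. \<gamma> t = (real t + 1) powr (- 1 / p)) \<longrightarrow>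
      (\<forall>tstar. output_index P \<pi> \<xi> \<gamma> T tstar \<longrightarrow>
        enn2ereal (\<integral>\<^sup>+\<omega>.
            (set_distance 0 (limiting_subdiff (moreau_envelope p (1 / (2 * \<rho>)) (\<lambda>x. ereal (F x)))
               (subgradient_iterate g \<gamma> x0 \<xi> (tstar \<omega>) \<omega>)))\<^sup>2 \<partial>P)
        \<le> ereal (2 * (p - 1)) *
             ((moreau_envelope p (1 / (2 * \<rho>)) (\<lambda>x. ereal (F x)) x0 - ereal (INF x. F x))
               / ereal ((real T + 2) powr (1 - 1 / p) - 1))
           + ereal (4 * \<rho> * (p - 1) * (2 powr (p - 1) * p + 1) / p *
               (L powr p * (ln (real T + 1) + 1) / ((real T + 2) powr (1 - 1 / p) - 1)))))"
proof -
  obtain z where z: "\<And>y. F z \<le> F y"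
    using min_exists by blast
  have INF: "(INF x. F x) = F z"
    using z by (intro antisym cINF_lower cINF_greatest bdd_belowI2) auto
  have setting: "stochastic_subgradient_setting F p r z \<rho> L \<pi> g" if "0 < r" "r * \<rho> < 1" for r
    using assms z that by unfold_locales auto
  have \<gamma>: "\<And>t. t \<le> T \<Longrightarrow> 0 < \<gamma> t"
    using assms by blast
  show ?thesis
    unfolding INF
  proof (intro conjI allI impI)
    fix r :: real
    assume r: "0 < r \<and> r < 1 / (2 powr (p - 1) * \<rho>)"
    \<comment> \<open>The assumed range of \<open>r\<close> is stronger than
      \<open>r * \<rho> < 1\<close>, as \<open>2 powr (p - 1)\<close> is at least
      \<open>1\<close>.\<close>
    have "1 * (r * \<rho>) \<le> 2 powr (p - 1) * (r * \<rho>)"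
      using r assms by (intro mult_right_mono ge_one_powr_ge_zero) auto
    also have "\<dots> < 1"
      using r assms by (simp add: field_simps)
    finally have "r * \<rho> < 1" by simp
    then interpret stochastic_subgradient_setting F p r z \<rho> L \<pi> g
      using r setting by blast
    let ?B = "p / (1 - r * \<rho>) * (gap x0 + (\<Sum>t\<le>T. noise (\<gamma> t)))"
    have "0 \<le> ?B"
      using p r_\<rho> gap_nonneg noise_nonneg by (intro mult_nonneg_nonneg add_nonneg_nonneg sum_nonneg) auto
    then have "enn2ereal (\<integral>\<^sup>+\<omega>. (\<Sum>t\<le>T. ennreal (\<gamma> t) * dist2 (subgradient_iterate g \<gamma> x0 \<xi> t \<omega>)) \<partial>P) \<le> ereal ?B"
      using weighted_dist2_bound[OF assms(8) \<gamma>, where ?x0.0 = x0]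
      by (intro enn2ereal_le_ereal)
    also have "?B \<le> p / (1 - r * \<rho>) * (env x0 - F z)
        + (2 powr (p - 1) * p + 1) * L powr p / (r * (1 - r * \<rho>)) * (\<Sum>t\<le>T. \<gamma> t powr p)"
      using sum_noise_le[where T = T and \<gamma> = \<gamma>] by (simp only: gap_def distrib_left add_left_mono)
    finally show "enn2ereal (\<integral>\<^sup>+\<omega>. (\<Sum>t\<le>T. ennreal (\<gamma> t) *
            (set_distance 0 (limiting_subdiff (moreau_envelope p r (\<lambda>x. ereal (F x)))
               (subgradient_iterate g \<gamma> x0 \<xi> t \<omega>)))\<^sup>2) \<partial>P)
        \<le> ereal (p / (1 - r * \<rho>)) *
             (moreau_envelope p r (\<lambda>x. ereal (F x)) x0 - ereal (F z))
           + ereal ((2 powr (p - 1) * p + 1) * L powr p / (r * (1 - r * \<rho>)) *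
               (\<Sum>t\<le>T. \<gamma> t powr p))"
      by (simp add: dist2_def moreau_envelope_eq)
  next
    fix tstar
    assume \<gamma>_eq: "\<forall>t\<le>T. \<gamma> t = (real t + 1) powr (- 1 / p)"
      and out: "output_index P \<pi> \<xi> \<gamma> T tstar"
    define r where "r = 1 / (2 * \<rho>)"
    \<comment> \<open>Hence \<open>p / (1 - r * \<rho>) = 2 * p\<close> and
      \<open>1 / (r * (1 - r * \<rho>)) = 4 * \<rho>\<close>, the sources of the numerical factors
      in the rate.\<close>
    have r_eq: "r * \<rho> = 1 / 2" "r > 0"
      using assms by (simp_all add: r_def)
    then interpret stochastic_subgradient_setting F p r z \<rho> L \<pi> g
      by (intro setting) auto
    define W where "W = (real T + 2) powr (1 - 1 / p) - 1"
    define C where "C = 2 powr (p - 1) * p + 1"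
    define l where "l = ln (real T + 1) + 1"
    have "(real T + 2) powr 0 < (real T + 2) powr (1 - 1 / p)"
      using p by (intro powr_less_mono) auto
    then have W: "W > 0"
      by (simp add: W_def)
    have sum_ge: "p / (p - 1) * W \<le> (\<Sum>t\<le>T. \<gamma> t)"
      using sum_powr_minus_ge[OF p, of T] \<gamma>_eq by (simp add: W_def)
    have sum_le: "(\<Sum>t\<le>T. \<gamma> t powr p) \<le> l"
      using sum_powr_minus_powr_le[of p T] \<gamma>_eq p by (simp add: l_def)
    have C: "C > 0"
      using p by (simp add: C_def add_nonneg_pos)
    let ?B = "p / (1 - r * \<rho>) * (gap x0 + (\<Sum>t\<le>T. noise (\<gamma> t)))"
    have B0: "0 \<le> ?B"
      using p r_\<rho> gap_nonneg noise_nonneg by (intro mult_nonneg_nonneg add_nonneg_nonneg sum_nonneg) auto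
    have "?B = 2 * p * gap x0 + p / (1 - r * \<rho>) * (\<Sum>t\<le>T. noise (\<gamma> t))"
      unfolding r_eq by (simp add: distrib_left)
    also have "p / (1 - r * \<rho>) * (\<Sum>t\<le>T. noise (\<gamma> t))
        \<le> C * L powr p / (r * (1 - r * \<rho>)) * (\<Sum>t\<le>T. \<gamma> t powr p)"
      unfolding C_def by (rule sum_noise_le)
    also have "\<dots> \<le> C * L powr p / (r * (1 - r * \<rho>)) * l"
      using C r_eq sum_le by (intro mult_left_mono) auto
    also have "C * L powr p / (r * (1 - r * \<rho>)) = 4 * \<rho> * C * L powr p"
      unfolding r_eq using \<rho> by (simp add: r_def)
    finally have B: "?B \<le> 2 * p * gap x0 + 4 * \<rho> * C * L powr p * l"
      by simp
    \<comment> \<open>Dividing by the lower bound \<open>p / (p - 1) * W\<close> of the step sum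
      contributes the factor \<open>(p - 1) / p\<close>, which turns \<open>2 * p\<close> into
      \<open>2 * (p - 1)\<close>.\<close>
    have "?B / (\<Sum>t\<le>T. \<gamma> t) \<le> ?B / (p / (p - 1) * W)"
      using p W B0 sum_ge by (intro divide_left_mono mult_pos_pos less_le_trans[OF _ sum_ge]) auto
    also have "\<dots> \<le> (2 * p * gap x0 + 4 * \<rho> * C * L powr p * l) / (p / (p - 1) * W)"
      using p W by (intro divide_right_mono B) auto
    also have "\<dots> = 2 * (p - 1) * (gap x0 / W) + 4 * \<rho> * (p - 1) * C / p * (L powr p * l / W)"
      using p W by (simp add: field_simps)
    finally have bound: "?B / (\<Sum>t\<le>T. \<gamma> t)
        \<le> 2 * (p - 1) * (gap x0 / W) + 4 * \<rho> * (p - 1) * C / p * (L powr p * l / W)" .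
    have "0 \<le> ?B / (\<Sum>t\<le>T. \<gamma> t)"
      using B0 \<gamma> by (intro divide_nonneg_nonneg sum_nonneg) (auto intro: less_imp_le)
    then have "enn2ereal (\<integral>\<^sup>+\<omega>. dist2 (subgradient_iterate g \<gamma> x0 \<xi> (tstar \<omega>) \<omega>) \<partial>P) \<le> ereal (?B / (\<Sum>t\<le>T. \<gamma> t))"
      using output_dist2_bound[OF assms(8) \<gamma> out, where ?x0.0 = x0]
      by (intro enn2ereal_le_ereal)
    also have "\<dots> \<le> ereal (2 * (p - 1) * (gap x0 / W) + 4 * \<rho> * (p - 1) * C / p * (L powr p * l / W))"
      using bound by simp
    also have "\<dots> = ereal (2 * (p - 1)) * ((moreau_envelope p r (\<lambda>x. ereal (F x)) x0 - ereal (F z)) / ereal W)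
        + ereal (4 * \<rho> * (p - 1) * C / p * (L powr p * l / W))"
      using W by (simp add: moreau_envelope_eq gap_def)
    finally show "enn2ereal (\<integral>\<^sup>+\<omega>.
            (set_distance 0 (limiting_subdiff (moreau_envelope p (1 / (2 * \<rho>)) (\<lambda>x. ereal (F x)))
               (subgradient_iterate g \<gamma> x0 \<xi> (tstar \<omega>) \<omega>)))\<^sup>2 \<partial>P)
        \<le> ereal (2 * (p - 1)) *
             ((moreau_envelope p (1 / (2 * \<rho>)) (\<lambda>x. ereal (F x)) x0 - ereal (F z))
               / ereal ((real T + 2) powr (1 - 1 / p) - 1))
           + ereal (4 * \<rho> * (p - 1) * (2 powr (p - 1) * p + 1) / p *
               (L powr p * (ln (real T + 1) + 1) / ((real T + 2) powr (1 - 1 / p) - 1)))"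
      unfolding dist2_def W_def C_def l_def unfolding r_def .
  qed
qed

end
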